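(* Let $k$ be a field of characteristic zero, let $p$ be a natural number, and let $D$ be an irreducible homogeneous locally nilpotent derivation of rank $2$ and degree $p-2$ on the polynomial ring $k[U,V,W]$. If $p$ is a prime number, then $D$ is triangularizable.
   Context: Let $k$ be a field of characteristic zero and $B=k[U,V,W]$ the polynomial ring in three variables over $k$. A locally nilpotent derivation (LND) of $B$ is a $k$-derivation $D:B\to B$ such that for each $b\in B$ there is $n$ with $D^n b=0$. Homogeneous and degree: $B$ has the standard grading $\deg U=\deg V=\deg W=1$, $B=\bigoplus_i B_i$. A nonzero $D$ is homogeneous of degree $d\in\mathbb{Z}$ if $D(B_i)\subseteq B_{i+d}$ for all $i$. Irreducible: the ideal of $B$ generated by $D(B)$ is not contained in any proper principal ideal of $B$. Rank: the smallest positive integer $r$ for which there is a coordinate system $\{V_1,V_2,V_3\}$ of $B$ (i.e. $B=k[V_1,V_2,V_3]$) with $DV_i\neq 0$ for $i\le r$ and $DV_i=0$ for $i>r$. Triangularizable: there is a coordinate system $\{X_1,X_2,X_3\}$ of $B$ with $DX_1\in k$, $DX_2\in k[X_1]$ and $DX_3\in k[X_1,X_2]$. *)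

theory Defs
  imports
    "HOL-Computational_Algebra.Polynomial"
    "HOL-Computational_Algebra.Primes"
begin

text \<open>
  The polynomial ring \<open>k[U,V,W]\<close> is the iterated ring \<open>k[U][V][W]\<close>:
  the coefficient of \<open>U ^ i * V ^ j * W ^ l\<close> in \<open>f\<close> is
  \<open>coeff (coeff (coeff f l) j) i\<close>.
\<close>

type_synonym 'k poly3 = "'k poly poly poly"

definition const3 :: "'k::comm_ring_1 \<Rightarrow> 'k poly3" where
  "const3 c = [:[:[:c:]:]:]"

text \<open>\<open>adjoin S\<close> is the \<open>k\<close>-subalgebra \<open>k[S]\<close> generated by \<open>S\<close>; in particular
  \<open>adjoin {}\<close> is the copy of \<open>k\<close> inside \<open>k[U,V,W]\<close>.\<close>

inductive_set adjoin :: "'k::comm_ring_1 poly3 set \<Rightarrow> 'k poly3 set"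
  for S :: "'k poly3 set" where
  const: "const3 c \<in> adjoin S"
| gen: "x \<in> S \<Longrightarrow> x \<in> adjoin S"
| add: "x \<in> adjoin S \<Longrightarrow> y \<in> adjoin S \<Longrightarrow> x + y \<in> adjoin S"
| mult: "x \<in> adjoin S \<Longrightarrow> y \<in> adjoin S \<Longrightarrow> x * y \<in> adjoin S"

definition coordinate_system :: "(nat \<Rightarrow> 'k::comm_ring_1 poly3) \<Rightarrow> bool" where
  "coordinate_system X \<longleftrightarrow> adjoin {X 1, X 2, X 3} = UNIV"

definition derivation :: "('k::comm_ring_1 poly3 \<Rightarrow> 'k poly3) \<Rightarrow> bool" where
  "derivation D \<longleftrightarrow>
     (\<forall>f g. D (f + g) = D f + D g) \<and>
     (\<forall>f g. D (f * g) = f * D g + D f * g) \<and>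
     (\<forall>c. D (const3 c) = 0)"

definition locally_nilpotent_derivation :: "('k::comm_ring_1 poly3 \<Rightarrow> 'k poly3) \<Rightarrow> bool" where
  "locally_nilpotent_derivation D \<longleftrightarrow> derivation D \<and> (\<forall>f. \<exists>n. (D ^^ n) f = 0)"

text \<open>The grading is indexed by \<open>int\<close>, with zero components in negative degrees, since a
  derivation may have negative degree.\<close>

definition homogeneous_component :: "int \<Rightarrow> 'k::comm_ring_1 poly3 set" where
  "homogeneous_component n =
     {f. \<forall>i j l. coeff (coeff (coeff f l) j) i \<noteq> 0 \<longrightarrow> int (i + j + l) = n}"

definition homogeneous_of_degree :: "('k::comm_ring_1 poly3 \<Rightarrow> 'k poly3) \<Rightarrow> int \<Rightarrow> bool" where
  "homogeneous_of_degree D d \<longleftrightarrow>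
     (\<exists>f. D f \<noteq> 0) \<and>
     (\<forall>i. D ` homogeneous_component i \<subseteq> homogeneous_component (i + d))"

text \<open>The ideal generated by a set is its span in the ring regarded as a module over itself.\<close>

lemma module_mult: "module ((*) :: 'a::comm_ring_1 \<Rightarrow> 'a \<Rightarrow> 'a)"
  by unfold_locales (simp_all add: algebra_simps)

abbreviation ideal_generated :: "'a::comm_ring_1 set \<Rightarrow> 'a set" where
  "ideal_generated \<equiv> module.span (*)"

definition irreducible_derivation :: "('k::comm_ring_1 poly3 \<Rightarrow> 'k poly3) \<Rightarrow> bool" where
  "irreducible_derivation D \<longleftrightarrow>
     \<not> (\<exists>a. ideal_generated {a} \<noteq> UNIV \<and> ideal_generated (range D) \<subseteq> ideal_generated {a})"

definition rank_witness :: "('k::comm_ring_1 poly3 \<Rightarrow> 'k poly3) \<Rightarrow> nat \<Rightarrow> bool" where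
  "rank_witness D r \<longleftrightarrow>
     (\<exists>X. coordinate_system X \<and> (\<forall>i\<in>{1..3}. if i \<le> r then D (X i) \<noteq> 0 else D (X i) = 0))"

text \<open>A relation rather than a \<open>LEAST\<close> term, because the zero derivation has no
  positive \<open>r\<close> as required.\<close>

definition has_rank :: "('k::comm_ring_1 poly3 \<Rightarrow> 'k poly3) \<Rightarrow> nat \<Rightarrow> bool" where
  "has_rank D r \<longleftrightarrow>
     0 < r \<and> rank_witness D r \<and> (\<forall>s. 0 < s \<and> rank_witness D s \<longrightarrow> r \<le> s)"

definition triangularizable :: "('k::comm_ring_1 poly3 \<Rightarrow> 'k poly3) \<Rightarrow> bool" where
  "triangularizable D \<longleftrightarrow>
     (\<exists>X. coordinate_system X \<and>
          D (X 1) \<in> range const3 \<and>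
          D (X 2) \<in> adjoin {X 1} \<and>
          D (X 3) \<in> adjoin {X 1, X 2})"

end

theory Submission
  imports Defs
begin

text \<open>
  The linear part of a coordinate in the kernel of \<open>D\<close> lies in the kernel as well, so one may assume
  \<open>D U = 0\<close>. A locally nilpotent derivation has divergence zero, hence \<open>D V = - dP/dW\<close> and
  \<open>D W = dP/dV\<close> for a form \<open>P\<close> of degree \<open>p\<close>, and \<open>U\<close> does not divide \<open>P\<close> since \<open>D\<close> is
  irreducible. Let \<open>m\<close> and \<open>n\<close> be the degrees of \<open>V\<close> and \<open>W\<close> with respect to \<open>D\<close>
  (the numbers of the last nonzero iterates). If \<open>m = n\<close>, then the leading terms of \<open>V\<close> and \<open>W\<close>
  satisfy the homogeneous relation \<open>P mod U\<close> over \<open>k\<close>, so they are proportional over \<open>k\<close> and a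
  linear substitution lowers \<open>n\<close>. If \<open>0 < n < m\<close>, then the top form of \<open>P\<close> for the weights
  \<open>(m, n)\<close> contains \<open>V^a\<close> and \<open>W^b\<close> for some \<open>a < b\<close>; comparing with the terms of \<open>P mod U\<close> gives
  \<open>b = p\<close>, and as \<open>p\<close> is prime there are no other terms. Then \<open>D W = dP/dV\<close> has degree
  \<open>(a - 1) m = n - 1 < m\<close>, so \<open>a = 1\<close> and \<open>P = c V + Q\<close> with \<open>c \<in> k[U]\<close> and \<open>Q \<in> k[U, W]\<close>.
\<close>

section \<open>Locally nilpotent derivations\<close>

text \<open>Only additivity and the Leibniz rule are required, so that the same facts serve
  \<open>D\<close> and the partial derivatives over any coefficient ring. \<open>ring_char_0\<close>
  keeps binomial coefficients and factorials nonzero.\<close>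

locale ring_derivation =
  fixes D :: "'r::{idom,ring_char_0} \<Rightarrow> 'r"
  assumes add: "D (f + g) = D f + D g"
    and mult: "D (f * g) = f * D g + D f * g"
begin

lemma zero [simp]: "D 0 = 0"
  using add[of 0 0] by simp

lemma one [simp]: "D 1 = 0"
  using mult[of 1 1] by simp

lemma minus: "D (- f) = - D f"
  using add[of f "- f"] by (simp add: eq_neg_iff_add_eq_0 add.commute)

lemma diff: "D (f - g) = D f - D g"
  using add[of f "- g"] by (simp add: minus)

lemma power_const: "D c = 0 \<Longrightarrow> D (c ^ n) = 0"
  by (induction n) (simp_all add: mult)

section \<open>Iterates of a derivation and the Leibniz formula\<close>

lemma funpow_0 [simp]: "(D ^^ n) 0 = 0"
  by (induction n) simp_all

lemma funpow_add_distrib: "(D ^^ n) (f + g) = (D ^^ n) f + (D ^^ n) g"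
  by (induction n) (simp_all add: add)

lemma funpow_const_mult: "D c = 0 \<Longrightarrow> (D ^^ n) (c * f) = c * (D ^^ n) f"
  by (induction n) (simp_all add: mult)

lemma funpow_eq_0_mono: "(D ^^ m) f = 0 \<Longrightarrow> m \<le> n \<Longrightarrow> (D ^^ n) f = 0"
  using funpow_add[of "n - m" m D] by simp

text \<open>In the Leibniz formula \<open>(D ^^ i) f\<close> is paired with
  \<open>(D ^^ (n - i)) g\<close>, and \<open>a + b <= n + 1\<close> forces \<open>i >= a\<close> or
  \<open>n - i >= b\<close>. The induction applies one \<open>D\<close> to the product
  first.\<close>

lemma funpow_mult_eq_0:
  "(D ^^ a) f = 0 \<Longrightarrow> (D ^^ b) g = 0 \<Longrightarrow> a + b \<le> Suc n \<Longrightarrow> (D ^^ n) (f * g) = 0"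
proof (induction n arbitrary: a b f g)
  case 0
  then have "a = 0 \<or> b = 0" by auto
  with 0 show ?case by auto
next
  case (Suc n)
  show ?case
  proof (cases "a = 0 \<or> b = 0")
    case True
    with Suc.prems have "f * g = 0" by auto
    then show ?thesis by (simp only: funpow_0)
  next
    case False
    then obtain a' b' where ab: "a = Suc a'" "b = Suc b'"
      by (metis not0_implies_Suc)
    have "(D ^^ n) (f * D g) = 0"
      by (rule Suc.IH[of a f b']) (use Suc.prems ab in \<open>simp_all add: funpow_swap1\<close>)
    moreover have "(D ^^ n) (D f * g) = 0"
      by (rule Suc.IH[of a' _ b]) (use Suc.prems ab in \<open>simp_all add: funpow_swap1\<close>)
    ultimately show ?thesis
      by (simp add: funpow_Suc_right mult funpow_add_distrib del: funpow.simps)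
  qed
qed

text \<open>Of the Leibniz expansion only the term with exactly \<open>m\<close> derivatives on
  \<open>f\<close> survives; the induction adds coefficients by Pascal's rule.\<close>

lemma funpow_mult_top:
  "(D ^^ Suc m) f = 0 \<Longrightarrow> (D ^^ Suc n) g = 0 \<Longrightarrow>
    (D ^^ (m + n)) (f * g) = of_nat ((m + n) choose m) * ((D ^^ m) f * (D ^^ n) g)"
proof (induction "m + n" arbitrary: m n f g)
  case 0
  then show ?case by simp
next
  case (Suc k)
  show ?case
  proof (cases m)
    case 0
    with Suc.prems have "D f = 0" by simp
    then show ?thesis using 0 by (simp add: funpow_const_mult)
  next
    case m: (Suc m')
    show ?thesis
    proof (cases n)
      case 0
      with Suc.prems have "D g = 0" by simp
      then show ?thesis using 0 funpow_const_mult[of g m f] by (simp add: mult.commute)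
    next
      case n: (Suc n')
      have 1: "(D ^^ (m + n')) (f * D g)
          = of_nat ((m + n') choose m) * ((D ^^ m) f * (D ^^ n') (D g))"
        by (rule Suc.hyps(1)) (use Suc.hyps(2) Suc.prems n in \<open>simp_all add: funpow_swap1\<close>)
      have 2: "(D ^^ (m' + n)) (D f * g)
          = of_nat ((m' + n) choose m') * ((D ^^ m') (D f) * (D ^^ n) g)"
        by (rule Suc.hyps(1)) (use Suc.hyps(2) Suc.prems m in \<open>simp_all add: funpow_swap1\<close>)
      have "(D ^^ (m + n)) (f * g) = (D ^^ (m + n')) (f * D g) + (D ^^ (m' + n)) (D f * g)"
        using funpow_add_distrib[of "m + n'" "f * D g" "D f * g"] m n
        by (simp add: mult funpow_swap1)
      also have "\<dots> = of_nat (((m + n') choose m) + ((m' + n) choose m')) * ((D ^^ m) f * (D ^^ n) g)"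
        unfolding 1 2 using m n by (simp add: funpow_swap1 distrib_right)
      also have "((m + n') choose m) + ((m' + n) choose m') = (m + n) choose m"
        using m n by simp
      finally show ?thesis .
    qed
  qed
qed

text \<open>\<open>u\<close> is the coefficient of \<open>t ^ m\<close> in
  \<open>exp(t D) f\<close>, a polynomial in \<open>t\<close> of degree at most \<open>m\<close>.
  Dividing out the factorial makes leading coefficients multiplicative; \<open>u = 0\<close> is
  allowed, so \<open>m\<close> is only an upper bound for the degree of \<open>f\<close>.\<close>

definition lead :: "nat \<Rightarrow> 'r \<Rightarrow> 'r \<Rightarrow> bool" where
  "lead m f u \<longleftrightarrow> (D ^^ Suc m) f = 0 \<and> (D ^^ m) f = fact m * u"

lemma lead_mult:
  assumes "lead m f u" "lead n g v"
  shows "lead (m + n) (f * g) (u * v)"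
proof -
  have z: "(D ^^ Suc m) f = 0" "(D ^^ Suc n) g = 0"
    using assms by (auto simp: lead_def)
  have "(D ^^ Suc (m + n)) (f * g) = 0"
    by (rule funpow_mult_eq_0[OF z]) simp
  moreover have "(D ^^ (m + n)) (f * g)
      = of_nat ((m + n) choose m) * (fact m * u * (fact n * v))"
    using funpow_mult_top[OF z] assms by (simp add: lead_def)
  moreover have "fact (m + n) = fact m * fact n * (of_nat ((m + n) choose m) :: 'r)"
    using binomial_fact_lemma[of m "m + n", THEN arg_cong[of _ _ "of_nat :: nat \<Rightarrow> 'r"]]
    by simp
  ultimately show ?thesis
    unfolding lead_def by (simp only: ac_simps)
qed

lemma lead_const: "D c = 0 \<Longrightarrow> lead 0 c c"
  by (simp add: lead_def)

lemma lead_power: "lead m f u \<Longrightarrow> lead (m * k) (f ^ k) (u ^ k)"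
proof (induction k)
  case 0
  then show ?case using lead_const[OF one] by simp
next
  case (Suc k)
  then show ?case using lead_mult[of m f u "m * k" "f ^ k" "u ^ k"] by simp
qed

lemma lead_add: "lead m f u \<Longrightarrow> lead m g v \<Longrightarrow> lead m (f + g) (u + v)"
  by (simp only: lead_def funpow_add_distrib distrib_left) simp

lemma lead_zero: "lead m 0 0"
  by (simp add: lead_def)

text \<open>This is how terms of smaller degree drop out of a sum.\<close>

lemma lead_mono: "lead m f u \<Longrightarrow> m < n \<Longrightarrow> lead n f 0"
  unfolding lead_def using funpow_eq_0_mono[of "Suc m" f n] funpow_eq_0_mono[of "Suc m" f "Suc n"]
  by (simp del: funpow.simps)

lemma lead_sum: "finite A \<Longrightarrow> (\<And>x. x \<in> A \<Longrightarrow> lead m (f x) (u x)) \<Longrightarrow> lead m (sum f A) (sum u A)"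
  by (induction A rule: finite_induct) (auto intro: lead_zero lead_add)

lemma lead_nonzero: "lead m f u \<Longrightarrow> u \<noteq> 0 \<Longrightarrow> (D ^^ m) f \<noteq> 0"
  by (simp add: lead_def)

lemma lead_unique:
  assumes "lead m f u" "lead n f v" "u \<noteq> 0" "v \<noteq> 0"
  shows "m = n"
proof (rule ccontr)
  assume "m \<noteq> n"
  then consider "m < n" | "n < m" by linarith
  then show False
    using lead_mono[of m f u n] lead_mono[of n f v m] assms
    by cases (auto simp: lead_def)
qed

section \<open>The degree function of a locally nilpotent derivation\<close>

lemma funpow_degree:
  assumes "(D ^^ k) f = 0" "f \<noteq> 0"
  obtains m where "(D ^^ m) f \<noteq> 0" "(D ^^ Suc m) f = 0"
proof -
  define k0 where "k0 = (LEAST k. (D ^^ k) f = 0)"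
  have k0: "(D ^^ k0) f = 0" unfolding k0_def by (rule LeastI) (rule assms)
  moreover have "k0 \<noteq> 0" using k0 assms(2) by (intro notI) simp
  then obtain m where m: "k0 = Suc m" by (metis not0_implies_Suc)
  moreover have "(D ^^ m) f \<noteq> 0"
    using not_less_Least[of m "\<lambda>k. (D ^^ k) f = 0"] m k0_def by auto
  ultimately show ?thesis using that by blast
qed

lemma funpow_degree_mult:
  assumes "(D ^^ m) f \<noteq> 0" "(D ^^ Suc m) f = 0" "(D ^^ n) g \<noteq> 0" "(D ^^ Suc n) g = 0"
  shows "(D ^^ (m + n)) (f * g) \<noteq> 0"
  using funpow_mult_top[OF assms(2,4)] assms(1,3) by (simp add: binomial_eq_0_iff)

text \<open>Degrees are additive, so a product of degree 0 has factors of degree 0: the kernel is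
  factorially closed.\<close>

lemma factor_in_kernel:
  assumes nil: "\<And>f. \<exists>n. (D ^^ n) f = 0" and "D (f * g) = 0" "g \<noteq> 0"
  shows "D f = 0"
proof (rule ccontr)
  assume df: "D f \<noteq> 0"
  then have "f \<noteq> 0" by auto
  then obtain m where m: "(D ^^ m) f \<noteq> 0" "(D ^^ Suc m) f = 0"
    using funpow_degree nil by metis
  obtain n where n: "(D ^^ n) g \<noteq> 0" "(D ^^ Suc n) g = 0"
    using funpow_degree nil \<open>g \<noteq> 0\<close> by metis
  have "m \<noteq> 0" using m df by (metis funpow_0 funpow_simps_right(1) id_apply comp_apply funpow.simps(2))
  then have "(D ^^ (m + n)) (f * g) = 0"
    using assms(2) funpow_eq_0_mono[of 1 "f * g" "m + n"] by simp
  with funpow_degree_mult[OF m n] show False by simp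
qed

text \<open>\<open>D\<close> lowers the degree of \<open>u\<close>, while multiplication by a
  nonzero \<open>h\<close> cannot lower it.\<close>

lemma eigenvalue_eq_0:
  assumes nil: "\<And>f. \<exists>n. (D ^^ n) f = 0" and "D u = h * u" "u \<noteq> 0"
  shows "h = 0"
proof (rule ccontr)
  assume h: "h \<noteq> 0"
  obtain m where m: "(D ^^ m) h \<noteq> 0" "(D ^^ Suc m) h = 0"
    using funpow_degree nil h by metis
  obtain n where n: "(D ^^ n) u \<noteq> 0" "(D ^^ Suc n) u = 0"
    using funpow_degree nil \<open>u \<noteq> 0\<close> by metis
  have "(D ^^ (m + n)) (D u) = 0"
    using funpow_eq_0_mono[OF n(2), of "Suc (m + n)"] by (simp add: funpow_swap1)
  with funpow_degree_mult[OF m n] assms(2) show False by simp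
qed

lemma nilpotent_add:
  assumes "(D ^^ a) f = 0" "(D ^^ b) g = 0"
  shows "\<exists>n. (D ^^ n) (f + g) = 0"
proof -
  have "(D ^^ (a + b)) f = 0" "(D ^^ (a + b)) g = 0"
    using assms funpow_eq_0_mono by auto
  then show ?thesis by (metis funpow_add_distrib add_0)
qed

end

text \<open>The Jacobian determinant is a bilinear operation on which \<open>D\<close> acts, up to the divergence,
  as on a product. Hence \<open>T = D + div D\<close> is nilpotent at \<open>1\<close>, and the last nonzero iterate
  is an eigenvector of \<open>D\<close> with eigenvalue \<open>- div D\<close>.\<close>

lemma divergence_eq_0:
  fixes D d1 d2 :: "'r::{idom,ring_char_0} \<Rightarrow> 'r"
  assumes "ring_derivation D" "ring_derivation d1" "ring_derivation d2"
    and comm: "\<And>f. d1 (d2 f) = d2 (d1 f)"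
    and D: "\<And>f. D f = d1 f * \<alpha> + d2 f * \<beta>"
    and xy: "d1 x = 1" "d2 x = 0" "d1 y = 0" "d2 y = 1"
    and nil: "\<And>f. \<exists>n. (D ^^ n) f = 0"
  shows "d1 \<alpha> + d2 \<beta> = 0"
proof -
  interpret D: ring_derivation D by fact
  interpret d1: ring_derivation d1 by fact
  interpret d2: ring_derivation d2 by fact
  define h where "h = d1 \<alpha> + d2 \<beta>"
  define J where "J f g = d1 f * d2 g - d2 f * d1 g" for f g
  define T where "T u = D u + h * u" for u
  have J0: "J 0 g = 0" "J f 0 = 0" for f g by (simp_all add: J_def)
  \<comment> \<open>Since \<open>d1\<close> and \<open>d2\<close> commute, the second derivatives of
    \<open>f\<close> and \<open>g\<close> match on both sides; the remaining terms, with derivatives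
    of \<open>\<alpha>\<close> and \<open>\<beta>\<close>, combine to
    \<open>h * J f g\<close>.\<close>
  have TJ: "T (J f g) = J (D f) g + J f (D g)" for f g
    by (simp add: T_def h_def J_def D d1.add d1.mult d1.diff d2.add d2.mult d2.diff comm algebra_simps)
  have T_add: "T (f + g) = T f + T g" for f g
    by (simp add: T_def D.add algebra_simps)
  have T0: "T 0 = 0" by (simp add: T_def)
  have Tn0: "(T ^^ n) 0 = 0" for n by (induction n) (simp_all add: T0)
  have Tn_add: "(T ^^ n) (f + g) = (T ^^ n) f + (T ^^ n) g" for n f g
    by (induction n) (simp_all add: T_add)
  \<comment> \<open>The Leibniz argument for products, with \<open>J\<close> in place of
    multiplication and \<open>T\<close> in place of \<open>D\<close>.\<close>
  have nilJ: "(D ^^ a) f = 0 \<Longrightarrow> (D ^^ b) g = 0 \<Longrightarrow> a + b \<le> Suc n \<Longrightarrow> (T ^^ n) (J f g) = 0"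
    for a b f g n
  proof (induction n arbitrary: a b f g)
    case 0
    then have "a = 0 \<or> b = 0" by auto
    with 0 show ?case by (auto simp: J0)
  next
    case (Suc n)
    show ?case
    proof (cases "a = 0 \<or> b = 0")
      case True
      with Suc.prems have "J f g = 0" by (auto simp: J0)
      then show ?thesis by (simp only: Tn0)
    next
      case False
      then obtain a' b' where ab: "a = Suc a'" "b = Suc b'"
        by (metis not0_implies_Suc)
      have "(T ^^ n) (J f (D g)) = 0"
        by (rule Suc.IH[of a f b']) (use Suc.prems ab in \<open>simp_all add: funpow_swap1\<close>)
      moreover have "(T ^^ n) (J (D f) g) = 0"
        by (rule Suc.IH[of a' _ b]) (use Suc.prems ab in \<open>simp_all add: funpow_swap1\<close>)
      ultimately show ?thesis
        by (simp add: funpow_Suc_right TJ Tn_add del: funpow.simps)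
    qed
  qed
  obtain a b where "(D ^^ a) x = 0" "(D ^^ b) y = 0" using nil by blast
  then have "(T ^^ (a + b)) (J x y) = 0" using nilJ by auto
  moreover have "J x y = 1" by (simp add: J_def xy)
  ultimately have ex: "(T ^^ (a + b)) 1 = 0" by simp
  define k where "k = (LEAST k. (T ^^ k) 1 = 0)"
  have k: "(T ^^ k) 1 = 0" unfolding k_def by (rule LeastI) (rule ex)
  then have "k \<noteq> 0" by (intro notI) simp
  then obtain i where i: "k = Suc i" by (metis not0_implies_Suc)
  have ne: "(T ^^ i) 1 \<noteq> 0"
    using not_less_Least[of i "\<lambda>k. (T ^^ k) 1 = 0"] i k_def by auto
  have "D ((T ^^ i) 1) = (- h) * (T ^^ i) 1"
    using k i by (simp add: T_def eq_neg_iff_add_eq_0)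
  then have "- h = 0"
    using D.eigenvalue_eq_0[OF nil _ ne] by blast
  then show ?thesis by (simp only: h_def neg_equal_0_iff_equal)
qed

section \<open>Polynomials in two variables\<close>

text \<open>\<open>k[U,V,W]\<close> is read as \<open>k[U][V,W]\<close>: two variables over a
  coefficient ring, with the exponent of the inner variable given first. At type
  \<open>poly3\<close>, \<open>var1\<close> and \<open>var2\<close> below are \<open>V\<close> and
  \<open>W\<close>.\<close>

definition coeff2 :: "'a::zero poly poly \<Rightarrow> nat \<Rightarrow> nat \<Rightarrow> 'a" where
  "coeff2 g j l = coeff (coeff g l) j"

definition monom2 :: "'a::zero \<Rightarrow> nat \<Rightarrow> nat \<Rightarrow> 'a poly poly" where
  "monom2 c j l = monom (monom c j) l"

definition var1 :: "'a::comm_semiring_1 poly poly" where "var1 = [:[:0, 1:]:]"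
definition var2 :: "'a::comm_semiring_1 poly poly" where "var2 = [:0, 1:]"

lemma poly2_eqI: "(\<And>j l. coeff2 f j l = coeff2 g j l) \<Longrightarrow> f = g"
  by (auto simp: coeff2_def intro!: poly_eqI)

lemma coeff2_0 [simp]: "coeff2 0 j l = 0"
  by (simp add: coeff2_def)

lemma coeff2_add [simp]: "coeff2 (f + g) j l = coeff2 f j l + coeff2 g j l"
  by (simp add: coeff2_def)

lemma coeff2_minus [simp]: "coeff2 (- f :: 'a::ab_group_add poly poly) j l = - coeff2 f j l"
  by (simp add: coeff2_def)

lemma coeff2_sum: "coeff2 (sum f A) j l = (\<Sum>x\<in>A. coeff2 (f x) j l)"
  by (simp add: coeff2_def coeff_sum)

lemma coeff2_mult:
  "coeff2 (f * g) j l = (\<Sum>i\<le>l. \<Sum>k\<le>j. coeff2 f k i * coeff2 g (j - k) (l - i))"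
  by (simp add: coeff2_def coeff_mult coeff_sum)

lemma coeff2_monom2: "coeff2 (monom2 c j l) j' l' = (if j = j' \<and> l = l' then c else 0)"
  by (simp add: coeff2_def monom2_def)

lemma monom2_eq:
  "monom2 (c :: 'a::comm_semiring_1) j l = [:[:c:]:] * var1 ^ j * var2 ^ l"
proof -
  have "[:[:c:]:] * [:[:0, 1:]:] ^ j = [:monom c j:]"
    by (induction j) (simp_all add: monom_0 monom_Suc ac_simps)
  moreover have "[:a:] * [:0, 1:] ^ l = monom a l" for a :: "'a poly"
    by (simp add: monom_altdef)
  ultimately show ?thesis by (simp add: monom2_def var1_def var2_def)
qed

definition supp2 :: "'a::zero poly poly \<Rightarrow> (nat \<times> nat) set" where
  "supp2 g = {(j, l). coeff2 g j l \<noteq> 0}"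

lemma finite_supp2: "finite (supp2 g)"
proof (rule finite_subset)
  show "supp2 g \<subseteq> (\<Union>l\<le>degree g. (\<lambda>j. (j, l)) ` {..degree (coeff g l)})"
  proof (intro subsetI)
    fix x assume "x \<in> supp2 g"
    then obtain j l where x: "x = (j, l)" "coeff (coeff g l) j \<noteq> 0"
      by (auto simp: supp2_def coeff2_def)
    then have "coeff g l \<noteq> 0" by auto
    with x show "x \<in> (\<Union>l\<le>degree g. (\<lambda>j. (j, l)) ` {..degree (coeff g l)})"
      using le_degree[of g l] le_degree[of "coeff g l" j] by auto
  qed
qed auto

lemma coeff2_sum_monom2:
  assumes "finite S"
  shows "coeff2 (\<Sum>(j, l)\<in>S. monom2 (c j l) j l) j' l' = (if (j', l') \<in> S then c j' l' else 0)"
proof -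
  have "coeff2 (\<Sum>(j, l)\<in>S. monom2 (c j l) j l) j' l'
      = (\<Sum>x\<in>S. if x = (j', l') then c j' l' else 0)"
    unfolding coeff2_sum
  proof (intro sum.cong refl)
    fix x
    show "coeff2 (case x of (j, l) \<Rightarrow> monom2 (c j l) j l) j' l' = (if x = (j', l') then c j' l' else 0)"
      by (cases x) (simp add: coeff2_monom2)
  qed
  then show ?thesis using sum.delta[OF assms, of "(j', l')" "\<lambda>_. c j' l'"] by (simp only:)
qed

lemma poly2_expansion: "g = (\<Sum>(j, l)\<in>supp2 g. monom2 (coeff2 g j l) j l)"
  by (rule poly2_eqI) (simp add: coeff2_sum_monom2 finite_supp2, simp add: supp2_def)

text \<open>The induction runs over the monomials of the fixed \<open>g\<close>, so hypotheses about
  the support of \<open>g\<close> remain available for each of them.\<close>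

lemma poly2_monom_induct:
  assumes "\<And>j l. coeff2 g j l \<noteq> 0 \<Longrightarrow> P (monom2 (coeff2 g j l) j l)"
    and "P 0" and "\<And>f h. P f \<Longrightarrow> P h \<Longrightarrow> P (f + h)"
  shows "P g"
proof -
  have "P (\<Sum>(j, l)\<in>S. monom2 (coeff2 g j l) j l)" if "finite S" "S \<subseteq> supp2 g" for S
    using that
  proof (induction S rule: finite_induct)
    case empty
    then show ?case using assms(2) by simp
  next
    case (insert x S)
    then show ?case
      using assms(1)[of "fst x" "snd x"] assms(3) by (cases x) (auto simp: supp2_def)
  qed
  from this[OF finite_supp2 order_refl] show ?thesis
    using poly2_expansion[of g] by simp
qed

lemma poly2_induct [case_names const var1 var2 add mult]:
  fixes P :: "'a::comm_semiring_1 poly poly \<Rightarrow> bool"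
  assumes const: "\<And>c. P [:[:c:]:]" and "P var1" "P var2"
    and add: "\<And>f g. P f \<Longrightarrow> P g \<Longrightarrow> P (f + g)" and mult: "\<And>f g. P f \<Longrightarrow> P g \<Longrightarrow> P (f * g)"
  shows "P g"
proof (rule poly2_monom_induct[of g])
  have 1: "P 1" using const[of 1] by (simp add: pCons_one)
  have pow: "P f \<Longrightarrow> P (f ^ n)" for f n
    by (induction n) (simp_all add: 1 mult)
  show "P (monom2 (coeff2 g j l) j l)" for j l
    unfolding monom2_eq by (intro mult pow const assms(2,3))
  show "P 0" using const[of 0] by simp
qed (rule add)

section \<open>The two partial derivatives\<close>

definition pderiv1 :: "'a::{comm_semiring_1,semiring_no_zero_divisors} poly poly \<Rightarrow> 'a poly poly" where
  "pderiv1 g = map_poly pderiv g"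

lemma coeff2_pderiv1: "coeff2 (pderiv1 g) j l = of_nat (Suc j) * coeff2 g (Suc j) l"
  by (simp add: coeff2_def pderiv1_def coeff_map_poly coeff_pderiv)

lemma coeff2_pderiv: "coeff2 (pderiv g) j l = of_nat (Suc l) * coeff2 g j (Suc l)"
proof -
  have "coeff (of_nat n * p) j = of_nat n * coeff p j" for n :: nat and p :: "'a poly"
    by (induction n) (simp_all add: algebra_simps)
  then show ?thesis by (simp add: coeff2_def coeff_pderiv del: of_nat_Suc)
qed

lemma ring_derivation_pderiv: "ring_derivation (pderiv :: 'a::{idom,ring_char_0} poly \<Rightarrow> 'a poly)"
  by unfold_locales (simp_all add: pderiv_add pderiv_mult)

lemma ring_derivation_pderiv1:
  "ring_derivation (pderiv1 :: 'a::{idom,ring_char_0} poly poly \<Rightarrow> 'a poly poly)"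
proof
  show "pderiv1 (f + g) = pderiv1 f + pderiv1 g" for f g :: "'a poly poly"
    by (rule poly2_eqI) (simp add: coeff2_pderiv1 algebra_simps)
  show "pderiv1 (f * g) = f * pderiv1 g + pderiv1 f * g" for f g :: "'a poly poly"
  proof (rule poly_eqI)
    interpret d: ring_derivation "pderiv :: 'a poly \<Rightarrow> 'a poly" by (rule ring_derivation_pderiv)
    have pderiv_sum: "pderiv (sum h A) = (\<Sum>x\<in>A. pderiv (h x))" if "finite A"
      for h :: "nat \<Rightarrow> 'a poly" and A
      using that by (induction A rule: finite_induct) (simp_all add: d.add)
    fix l
    show "coeff (pderiv1 (f * g)) l = coeff (f * pderiv1 g + pderiv1 f * g) l"
    proof -
      have "coeff (pderiv1 (f * g)) l = pderiv (\<Sum>i\<le>l. coeff f i * coeff g (l - i))"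
        by (simp add: pderiv1_def coeff_map_poly coeff_mult)
      also have "\<dots> = (\<Sum>i\<le>l. pderiv (coeff f i * coeff g (l - i)))"
        by (rule pderiv_sum) simp
      also have "\<dots> = coeff (f * pderiv1 g + pderiv1 f * g) l"
        by (simp only: d.mult sum.distrib pderiv1_def coeff_add coeff_mult coeff_map_poly pderiv_0)
      finally show ?thesis .
    qed
  qed
qed

lemma pderiv1_pderiv: "pderiv1 (pderiv g) = pderiv (pderiv1 g)"
  by (rule poly2_eqI) (simp add: coeff2_pderiv1 coeff2_pderiv ac_simps del: of_nat_Suc)

lemma pderiv_vars:
  "pderiv1 (var1 :: 'a::{idom,ring_char_0} poly poly) = 1" "pderiv1 var2 = (0 :: 'a poly poly)"
  "pderiv (var1 :: 'a poly poly) = 0" "pderiv var2 = (1 :: 'a poly poly)"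
  "pderiv1 [:[:c:]:] = (0 :: 'a poly poly)" "pderiv [:[:c:]:] = (0 :: 'a poly poly)"
  by (simp_all add: pderiv1_def var1_def var2_def map_poly_pCons pderiv_pCons pCons_one map_poly_1)

text \<open>Both sides are derivations over the constants, hence agree once they agree on the two
  variables.\<close>

lemma derivation_eq_pderiv:
  fixes D :: "'a::{idom,ring_char_0} poly poly \<Rightarrow> 'a poly poly"
  assumes "ring_derivation D" "\<And>c. D [:[:c:]:] = 0"
  shows "D g = pderiv1 g * D var1 + pderiv g * D var2"
proof -
  interpret D: ring_derivation D by fact
  interpret d1: ring_derivation "pderiv1 :: 'a poly poly \<Rightarrow> _" by (rule ring_derivation_pderiv1)
  interpret d2: ring_derivation "pderiv :: 'a poly poly \<Rightarrow> _" by (rule ring_derivation_pderiv)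
  show ?thesis
    by (induction g rule: poly2_induct)
      (simp_all add: assms(2) pderiv_vars D.add d1.add d2.add D.mult d1.mult d2.mult algebra_simps)
qed

lemma ring_derivation_pderiv_combination:
  fixes \<alpha> \<beta> :: "'a::{idom,ring_char_0} poly poly"
  shows "ring_derivation (\<lambda>g. pderiv1 g * \<alpha> + pderiv g * \<beta>)"
proof -
  interpret d1: ring_derivation "pderiv1 :: 'a poly poly \<Rightarrow> _" by (rule ring_derivation_pderiv1)
  interpret d2: ring_derivation "pderiv :: 'a poly poly \<Rightarrow> _" by (rule ring_derivation_pderiv)
  show ?thesis
    by unfold_locales (simp_all add: d1.add d2.add d1.mult d2.mult algebra_simps)
qed

text \<open>Elements killed by some iterate form a subring, so local nilpotency need only be checked
  on generators.\<close>

lemma nilpotent_if_vars_nilpotent: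
  fixes D :: "'a::{idom,ring_char_0} poly poly \<Rightarrow> 'a poly poly"
  assumes "ring_derivation D" "\<And>c. D [:[:c:]:] = 0"
    and "\<exists>n. (D ^^ n) var1 = 0" "\<exists>n. (D ^^ n) var2 = 0"
  shows "\<exists>n. (D ^^ n) g = 0"
proof -
  interpret D: ring_derivation D by fact
  show ?thesis
  proof (induction g rule: poly2_induct)
    case (const c)
    then show ?case using assms(2) by (intro exI[of _ 1]) simp
  next
    case (add f g)
    then show ?case using D.nilpotent_add by blast
  next
    case (mult f g)
    then obtain a b where "(D ^^ a) f = 0" "(D ^^ b) g = 0" by blast
    then have "(D ^^ (a + b)) (f * g) = 0" using D.funpow_mult_eq_0 by auto
    then show ?case by blast
  qed (use assms in auto)
qed

text \<open>A polynomial Poincare lemma, proved by integrating coefficients. The coefficient ring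
  will be \<open>k[U]\<close>, not a field, so invertibility of positive integers is a
  hypothesis.\<close>

lemma divergence_free_eq_jacobian:
  fixes \<alpha> \<beta> :: "'a::{idom,ring_char_0} poly poly"
  assumes unit: "\<And>n. (of_nat (Suc n) :: 'a) dvd 1"
    and div0: "pderiv1 \<alpha> + pderiv \<beta> = 0"
  shows "\<exists>P. pderiv1 P = \<beta> \<and> pderiv P = - \<alpha>"
proof -
  have "\<forall>n. \<exists>r. of_nat (Suc n) * (r :: 'a) = 1"
    using unit by (metis dvdE)
  then obtain r where r: "\<And>n. of_nat (Suc n) * (r n :: 'a) = 1"
    by metis
  \<comment> \<open>Monomials containing \<open>var2\<close> are integrated from
    \<open>- \<alpha>\<close>, pure powers of \<open>var1\<close> from \<open>\<beta>\<close>; the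
    constant of integration is 0.\<close>
  define c where "c j l = (case l of Suc l' \<Rightarrow> - (r l' * coeff2 \<alpha> j l')
      | 0 \<Rightarrow> (case j of Suc j' \<Rightarrow> r j' * coeff2 \<beta> j' 0 | 0 \<Rightarrow> 0))" for j l
  define S where "S = (\<lambda>(j, l). (j, Suc l)) ` supp2 \<alpha> \<union> (\<lambda>(j, l). (Suc j, l)) ` supp2 \<beta>"
  define P where "P = (\<Sum>(j, l)\<in>S. monom2 (c j l) j l)"
  have "finite S" by (simp add: S_def finite_supp2)
  moreover have "c j l = 0" if "(j, l) \<notin> S" for j l
    using that by (force simp: c_def S_def supp2_def split: nat.splits)
  ultimately have P: "coeff2 P j l = c j l" for j l
    unfolding P_def by (subst coeff2_sum_monom2) auto
  \<comment> \<open>Zero divergence, read on coefficients: the terms integrated from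
    \<open>\<alpha>\<close> thereby also have the right derivative by \<open>var1\<close>.\<close>
  have closed: "of_nat (Suc j) * coeff2 \<alpha> (Suc j) l = - (of_nat (Suc l) * coeff2 \<beta> j (Suc l))" for j l
    using arg_cong[OF div0, of "\<lambda>g. coeff2 g j l"]
    by (simp only: coeff2_add coeff2_pderiv1 coeff2_pderiv coeff2_0 eq_neg_iff_add_eq_0)
  have "pderiv P = - \<alpha>"
  proof (rule poly2_eqI)
    fix j l
    have "coeff2 (pderiv P) j l = - ((of_nat (Suc l) * r l) * coeff2 \<alpha> j l)"
      by (simp add: coeff2_pderiv P c_def ac_simps del: of_nat_Suc)
    then show "coeff2 (pderiv P) j l = coeff2 (- \<alpha>) j l"
      by (simp only: r) simp
  qed
  moreover have "pderiv1 P = \<beta>"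
  proof (rule poly2_eqI)
    fix j l
    show "coeff2 (pderiv1 P) j l = coeff2 \<beta> j l"
    proof (cases l)
      case 0
      then have "coeff2 (pderiv1 P) j l = (of_nat (Suc j) * r j) * coeff2 \<beta> j l"
        by (simp add: coeff2_pderiv1 P c_def ac_simps del: of_nat_Suc)
      then show ?thesis by (simp only: r) simp
    next
      case (Suc l')
      then have "coeff2 (pderiv1 P) j l = - (r l' * (of_nat (Suc j) * coeff2 \<alpha> (Suc j) l'))"
        by (simp add: coeff2_pderiv1 P c_def ac_simps del: of_nat_Suc)
      also have "\<dots> = (of_nat (Suc l') * r l') * coeff2 \<beta> j l"
        using Suc by (simp only: closed) (simp add: ac_simps del: of_nat_Suc)
      finally show ?thesis by (simp only: r) simp
    qed
  qed
  ultimately show ?thesis by blast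
qed

section \<open>Weighted top forms\<close>

text \<open>Bounds are integers because differentiation lowers them by \<open>m\<close> or
  \<open>n\<close>, and iterates may push them below zero, where \<open>wle\<close> leaves only the
  zero polynomial.\<close>

definition wle :: "nat \<Rightarrow> nat \<Rightarrow> int \<Rightarrow> 'a::zero poly poly \<Rightarrow> bool" where
  "wle m n e g \<longleftrightarrow> (\<forall>j l. coeff2 g j l \<noteq> 0 \<longrightarrow> int (m * j + n * l) \<le> e)"

definition wtop :: "nat \<Rightarrow> nat \<Rightarrow> int \<Rightarrow> 'a::comm_monoid_add poly poly \<Rightarrow> 'a poly poly" where
  "wtop m n e g = (\<Sum>(j, l)\<in>{(j, l) \<in> supp2 g. int (m * j + n * l) = e}. monom2 (coeff2 g j l) j l)"

lemma coeff2_wtop: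
  "coeff2 (wtop m n e g) j l = (if int (m * j + n * l) = e then coeff2 g j l else 0)"
proof -
  have "finite {(j, l) \<in> supp2 g. int (m * j + n * l) = e}"
    by (rule finite_subset[OF _ finite_supp2[of g]]) auto
  then show ?thesis
    unfolding wtop_def by (subst coeff2_sum_monom2) (auto simp: supp2_def)
qed

lemma wle_add: "wle m n e f \<Longrightarrow> wle m n e g \<Longrightarrow> wle m n e (f + g)"
  for f g :: "'a::comm_monoid_add poly poly"
  unfolding wle_def coeff2_add by (metis add_0)

lemma wtop_add: "wtop m n e (f + g) = wtop m n e f + wtop m n e g"
  by (rule poly2_eqI) (simp add: coeff2_wtop)

lemma wle_minus: "wle m n e f \<Longrightarrow> wle m n e (- f)" for f :: "'a::ab_group_add poly poly"
  by (simp add: wle_def)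

lemma wtop_minus: "wtop m n e (- f) = - wtop m n e f" for f :: "'a::ab_group_add poly poly"
  by (rule poly2_eqI) (simp add: coeff2_wtop)

lemma weight_split:
  fixes m n :: nat
  assumes "i \<le> l" "k \<le> j"
  shows "m * j + n * l = (m * k + n * i) + (m * (j - k) + n * (l - i))"
proof -
  obtain i' k' where "l = i + i'" "j = k + k'" using assms by (auto simp: le_iff_add)
  then show ?thesis by (simp add: algebra_simps)
qed

lemma wle_mult:
  fixes f g :: "'a::comm_ring_1 poly poly"
  assumes "wle m n e f" "wle m n e' g"
  shows "wle m n (e + e') (f * g)"
  unfolding wle_def
proof (intro allI impI)
  fix j l assume "coeff2 (f * g) j l \<noteq> 0"
  then obtain i k where ik: "i \<le> l" "k \<le> j" "coeff2 f k i * coeff2 g (j - k) (l - i) \<noteq> 0"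
    unfolding coeff2_mult by (meson atMost_iff sum.not_neutral_contains_not_neutral)
  then have "coeff2 f k i \<noteq> 0" "coeff2 g (j - k) (l - i) \<noteq> 0" by auto
  then have "int (m * k + n * i) + int (m * (j - k) + n * (l - i)) \<le> e + e'"
    using assms unfolding wle_def by (intro add_mono) blast+
  then show "int (m * j + n * l) \<le> e + e'"
    unfolding weight_split[OF ik(1,2)] by (simp only: of_nat_add)
qed

text \<open>A product of monomials reaches weight \<open>e + e'\<close> only if both factors attain
  their bounds.\<close>

lemma wtop_mult:
  fixes f g :: "'a::comm_ring_1 poly poly"
  assumes "wle m n e f" "wle m n e' g"
  shows "wtop m n (e + e') (f * g) = wtop m n e f * wtop m n e' g"
proof (rule poly2_eqI)
  fix j l
  have summand: "coeff2 (wtop m n e f) k i * coeff2 (wtop m n e' g) (j - k) (l - i)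
      = (if int (m * j + n * l) = e + e' then coeff2 f k i * coeff2 g (j - k) (l - i) else 0)"
    if "i \<le> l" "k \<le> j" for i k
  proof (cases "coeff2 f k i = 0 \<or> coeff2 g (j - k) (l - i) = 0")
    case True
    then show ?thesis by (auto simp: coeff2_wtop)
  next
    case False
    then have "int (m * k + n * i) \<le> e" "int (m * (j - k) + n * (l - i)) \<le> e'"
      using assms unfolding wle_def by blast+
    moreover have "int (m * j + n * l) = int (m * k + n * i) + int (m * (j - k) + n * (l - i))"
      unfolding weight_split[OF that] by (rule of_nat_add)
    ultimately show ?thesis by (simp add: coeff2_wtop del: of_nat_add of_nat_mult)
  qed
  have "coeff2 (wtop m n e f * wtop m n e' g) j l
      = (\<Sum>i\<le>l. \<Sum>k\<le>j. if int (m * j + n * l) = e + e' then coeff2 f k i * coeff2 g (j - k) (l - i) else 0)"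
    unfolding coeff2_mult by (intro sum.cong refl summand) auto
  also have "\<dots> = coeff2 (wtop m n (e + e') (f * g)) j l"
    by (simp add: coeff2_wtop coeff2_mult)
  finally show "coeff2 (wtop m n (e + e') (f * g)) j l = coeff2 (wtop m n e f * wtop m n e' g) j l" ..
qed

context
  fixes m n :: nat and e :: int and g :: "'a::{idom,ring_char_0} poly poly"
begin

lemma wle_pderiv1: "wle m n e g \<Longrightarrow> wle m n (e - int m) (pderiv1 g)"
proof (unfold wle_def coeff2_pderiv1, intro allI impI)
  fix j l
  assume "\<forall>j l. coeff2 g j l \<noteq> 0 \<longrightarrow> int (m * j + n * l) \<le> e"
    and "of_nat (Suc j) * coeff2 g (Suc j) l \<noteq> 0"
  then have "int (m * Suc j + n * l) \<le> e" by (metis mult_zero_right)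
  then show "int (m * j + n * l) \<le> e - int m" by (simp add: algebra_simps)
qed

lemma wle_pderiv: "wle m n e g \<Longrightarrow> wle m n (e - int n) (pderiv g)"
proof (unfold wle_def coeff2_pderiv, intro allI impI)
  fix j l
  assume "\<forall>j l. coeff2 g j l \<noteq> 0 \<longrightarrow> int (m * j + n * l) \<le> e"
    and "of_nat (Suc l) * coeff2 g j (Suc l) \<noteq> 0"
  then have "int (m * j + n * Suc l) \<le> e" by (metis mult_zero_right)
  then show "int (m * j + n * l) \<le> e - int n" by (simp add: algebra_simps)
qed

lemma wtop_pderiv1: "wtop m n (e - int m) (pderiv1 g) = pderiv1 (wtop m n e g)"
  by (rule poly2_eqI) (auto simp: coeff2_pderiv1 coeff2_wtop algebra_simps)

lemma wtop_pderiv: "wtop m n (e - int n) (pderiv g) = pderiv (wtop m n e g)"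
  by (rule poly2_eqI) (auto simp: coeff2_pderiv coeff2_wtop algebra_simps)

end

text \<open>The Jacobian determinant of \<open>(P, g)\<close> as a function of \<open>g\<close>,
  i.e. the Hamiltonian vector field of \<open>P\<close>.\<close>

definition jac :: "'a::{idom,ring_char_0} poly poly \<Rightarrow> 'a poly poly \<Rightarrow> 'a poly poly" where
  "jac P g = pderiv g * pderiv1 P - pderiv1 g * pderiv P"

lemma ring_derivation_jac: "ring_derivation (jac P)"
  using ring_derivation_pderiv_combination[of "- pderiv P" "pderiv1 P"]
  unfolding jac_def[abs_def] by (simp add: algebra_simps)

lemma jac_self: "jac P P = 0"
  by (simp add: jac_def)

lemma jac_const: "jac P [:[:c:]:] = 0"
  by (simp add: jac_def pderiv_vars)

lemma jac_vars: "jac P var1 = - pderiv P" "jac P var2 = pderiv1 P"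
  by (simp_all add: jac_def pderiv_vars)

text \<open>Each product in the Jacobian differentiates once by each variable, so
  \<open>jac P\<close> raises weights by at most \<open>M - m - n\<close>, possibly a negative
  number.\<close>

lemma wtop_jac:
  assumes "wle m n M P" "wle m n e g"
  shows "wle m n (e + (M - int m - int n)) (jac P g)"
    and "wtop m n (e + (M - int m - int n)) (jac P g) = jac (wtop m n M P) (wtop m n e g)"
proof -
  have e1: "e + (M - int m - int n) = (e - int n) + (M - int m)"
    and e2: "e + (M - int m - int n) = (e - int m) + (M - int n)" by simp_all
  note le = wle_pderiv[OF assms(2)] wle_pderiv1[OF assms(1)] wle_pderiv1[OF assms(2)] wle_pderiv[OF assms(1)]
  have 1: "wle m n (e + (M - int m - int n)) (pderiv g * pderiv1 P)"
    unfolding e1 by (rule wle_mult[OF le(1,2)])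
  have 2: "wle m n (e + (M - int m - int n)) (- (pderiv1 g * pderiv P))"
    unfolding e2 by (rule wle_minus[OF wle_mult[OF le(3,4)]])
  have jac: "jac P g = pderiv g * pderiv1 P + - (pderiv1 g * pderiv P)" for P g :: "'a poly poly"
    by (simp add: jac_def)
  show "wle m n (e + (M - int m - int n)) (jac P g)"
    unfolding jac by (rule wle_add[OF 1 2])
  have "wtop m n (e + (M - int m - int n)) (pderiv g * pderiv1 P)
      = pderiv (wtop m n e g) * pderiv1 (wtop m n M P)"
    unfolding e1 wtop_mult[OF le(1,2)] by (simp add: wtop_pderiv wtop_pderiv1)
  moreover have "wtop m n (e + (M - int m - int n)) (pderiv1 g * pderiv P)
      = pderiv1 (wtop m n e g) * pderiv (wtop m n M P)"
    unfolding e2 wtop_mult[OF le(3,4)] by (simp add: wtop_pderiv wtop_pderiv1)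
  ultimately show "wtop m n (e + (M - int m - int n)) (jac P g) = jac (wtop m n M P) (wtop m n e g)"
    unfolding jac wtop_add wtop_minus by simp
qed

lemma wtop_jac_funpow:
  assumes "wle m n M P" "wle m n e g"
  shows "wle m n (e + int k * (M - int m - int n)) ((jac P ^^ k) g) \<and>
    wtop m n (e + int k * (M - int m - int n)) ((jac P ^^ k) g) = (jac (wtop m n M P) ^^ k) (wtop m n e g)"
proof (induction k)
  case 0
  then show ?case using assms by simp
next
  case (Suc k)
  have "e + int (Suc k) * (M - int m - int n)
      = (e + int k * (M - int m - int n)) + (M - int m - int n)"
    by (simp add: algebra_simps)
  then show ?case
    using wtop_jac[OF assms(1) Suc.IH[THEN conjunct1]] Suc.IH by (simp only: funpow.simps comp_apply simp_thms)
qed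

text \<open>The top form of an iterate is the iterate of the top part, so on a weighted homogeneous
  element nilpotency is inherited from \<open>jac P\<close>. Both variables are weighted
  homogeneous, and they generate.\<close>

lemma wtop_jac_nilpotent:
  assumes "wle m n M P" and nil: "\<And>g. \<exists>k. (jac P ^^ k) g = 0"
  shows "\<exists>k. (jac (wtop m n M P) ^^ k) g = 0"
proof (rule nilpotent_if_vars_nilpotent[OF ring_derivation_jac jac_const])
  have *: "\<exists>k. (jac (wtop m n M P) ^^ k) g = 0" if "wle m n e g" "wtop m n e g = g" for e g
  proof -
    obtain k where k: "(jac P ^^ k) g = 0" using nil by blast
    have "wtop m n e' (0 :: 'a poly poly) = 0" for e'
      by (rule poly2_eqI) (simp add: coeff2_wtop)
    with wtop_jac_funpow[OF assms(1) that(1), of k] that(2) k show ?thesis by metis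
  qed
  have var1: "coeff2 (var1 :: 'a poly poly) j l = (if j = 1 \<and> l = 0 then 1 else 0)"
    and var2: "coeff2 (var2 :: 'a poly poly) j l = (if j = 0 \<and> l = 1 then 1 else 0)" for j l
    using coeff2_monom2[of "1 :: 'a" 1 0 j l] coeff2_monom2[of "1 :: 'a" 0 1 j l]
    by (auto simp: monom2_eq pCons_one)
  show "\<exists>k. (jac (wtop m n M P) ^^ k) var1 = 0"
    by (rule *[of m], simp add: wle_def var1, rule poly2_eqI, simp add: var1 coeff2_wtop)
  show "\<exists>k. (jac (wtop m n M P) ^^ k) var2 = 0"
    by (rule *[of n], simp add: wle_def var2, rule poly2_eqI, simp add: var2 coeff2_wtop)
qed

section \<open>Divisibility by a variable and leading terms of polynomials\<close>

lemma dvd_if_coeff2_dvd: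
  fixes g :: "'a::comm_ring_1 poly poly"
  assumes "\<And>j l. coeff2 g j l \<noteq> 0 \<Longrightarrow> d dvd monom2 (coeff2 g j l) j l"
  shows "d dvd g"
  by (rule poly2_monom_induct[where P = "\<lambda>g. d dvd g"]) (auto intro: assms dvd_add)

lemma var_dvd_monom2:
  "0 < j \<Longrightarrow> var1 dvd monom2 (c :: 'a::comm_ring_1) j l"
  "0 < l \<Longrightarrow> var2 dvd monom2 (c :: 'a::comm_ring_1) j l"
  unfolding monom2_eq
  by (rule dvd_mult2, rule dvd_mult, rule dvd_power, simp) (rule dvd_mult, rule dvd_power, simp)

context
  fixes D :: "'a::{idom,ring_char_0} poly poly \<Rightarrow> 'a poly poly" and m n u v
  assumes D: "ring_derivation D" and const: "\<And>c. D [:[:c:]:] = 0"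
    and u: "ring_derivation.lead D m var1 u" and v: "ring_derivation.lead D n var2 v"
begin

interpretation D: ring_derivation D by (rule D)

text \<open>By multiplicativity each monomial leads with \<open>u ^ j * v ^ l\<close> at the bound
  \<open>m * j + n * l\<close>; those below \<open>e\<close> contribute nothing. The sum may cancel
  to zero, which is the relation exploited when \<open>m = n\<close>.\<close>

lemma lead_expansion:
  assumes "\<And>j l. coeff2 g j l \<noteq> 0 \<Longrightarrow> m * j + n * l \<le> e"
  shows "D.lead e g (\<Sum>(j, l)\<in>{(j, l) \<in> supp2 g. m * j + n * l = e}. [:[:coeff2 g j l:]:] * u ^ j * v ^ l)"
proof -
  have monom: "D.lead (m * j + n * l) (monom2 c j l) ([:[:c:]:] * u ^ j * v ^ l)" for c j l
    using D.lead_mult[OF D.lead_mult[OF D.lead_const[OF const] D.lead_power[OF u]] D.lead_power[OF v]]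
    unfolding monom2_eq by simp
  have "D.lead e (\<Sum>x\<in>supp2 g. monom2 (coeff2 g (fst x) (snd x)) (fst x) (snd x))
     (\<Sum>x\<in>supp2 g. if m * fst x + n * snd x = e
        then [:[:coeff2 g (fst x) (snd x):]:] * u ^ fst x * v ^ snd x else 0)"
  proof (rule D.lead_sum[OF finite_supp2])
    fix x assume "x \<in> supp2 g"
    then have "m * fst x + n * snd x \<le> e" using assms by (auto simp: supp2_def)
    then show "D.lead e (monom2 (coeff2 g (fst x) (snd x)) (fst x) (snd x))
      (if m * fst x + n * snd x = e
        then [:[:coeff2 g (fst x) (snd x):]:] * u ^ fst x * v ^ snd x else 0)"
      using monom[of "fst x" "snd x" "coeff2 g (fst x) (snd x)"] D.lead_mono by force
  qed
  moreover have "(\<Sum>x\<in>supp2 g. if m * fst x + n * snd x = e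
        then [:[:coeff2 g (fst x) (snd x):]:] * u ^ fst x * v ^ snd x else 0)
     = (\<Sum>(j, l)\<in>{(j, l) \<in> supp2 g. m * j + n * l = e}. [:[:coeff2 g j l:]:] * u ^ j * v ^ l)"
    by (subst sum.inter_filter[OF finite_supp2, symmetric]) (simp add: case_prod_unfold)
  ultimately show ?thesis
    using poly2_expansion[of g] by (simp add: case_prod_unfold)
qed

text \<open>A single monomial on the top line cannot be cancelled, so for nonzero \<open>u\<close>
  and \<open>v\<close> the bound \<open>e\<close> is the true degree of \<open>g\<close>.\<close>

lemma lead_single_top:
  assumes "\<And>j l. coeff2 g j l \<noteq> 0 \<Longrightarrow> m * j + n * l \<le> e"
    and "{(j, l) \<in> supp2 g. m * j + n * l = e} = {(a, b)}"
  shows "D.lead e g ([:[:coeff2 g a b:]:] * u ^ a * v ^ b)" "coeff2 g a b \<noteq> 0"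
proof -
  show "D.lead e g ([:[:coeff2 g a b:]:] * u ^ a * v ^ b)"
    using lead_expansion[of g e] assms by simp
  show "coeff2 g a b \<noteq> 0" using assms(2) by (auto simp: supp2_def)
qed

text \<open>The top form of \<open>P\<close> for the weights \<open>(m, n)\<close> lies in the kernel of the top part of \<open>D\<close>,
  which is again locally nilpotent. It is not a monomial, since otherwise the weights would give
  \<open>P\<close> a positive degree; so no variable lies in that kernel, and none divides the top form.\<close>

lemma prime_degree_support:
  assumes nil: "\<And>g. \<exists>k. (D ^^ k) g = 0"
    and nz: "u \<noteq> 0" "v \<noteq> 0" and mn: "0 < n" "n < m"
    and P: "pderiv1 P = D var2" "pderiv P = - D var1"
    and supp: "\<And>j l. coeff2 P j l \<noteq> 0 \<Longrightarrow> j + l \<le> p"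
    and top: "coeff2 P j0 l0 \<noteq> 0" "j0 + l0 = p"
    and "prime p" and jl: "coeff2 P j l \<noteq> 0"
  shows "j = 0 \<or> (j = 1 \<and> l = 0)"
proof -
  have p: "p \<ge> 2" using \<open>prime p\<close> by (rule prime_ge_2_nat)
  have D_jac: "D = jac P"
  proof
    fix g show "D g = jac P g"
      using derivation_eq_pderiv[OF D const, of g] P by (simp add: jac_def algebra_simps)
  qed
  define M where "M = Max ((\<lambda>(j, l). m * j + n * l) ` supp2 P)"
  have le_M: "m * j + n * l \<le> M" if "coeff2 P j l \<noteq> 0" for j l
  proof -
    have "(j, l) \<in> supp2 P" using that by (simp add: supp2_def)
    from imageI[OF this, of "\<lambda>(j, l). m * j + n * l"] show ?thesis
      unfolding M_def using finite_supp2[of P] by (intro Max_ge) simp_all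
  qed
  have "M \<in> (\<lambda>(j, l). m * j + n * l) ` supp2 P"
    unfolding M_def using top(1) finite_supp2[of P] by (intro Max_in) (auto simp: supp2_def)
  then obtain j1 l1 where M1: "coeff2 P j1 l1 \<noteq> 0" "m * j1 + n * l1 = M"
    by (auto simp: supp2_def)
  have M0: "0 < M"
  proof -
    have "0 < m * j0 + n * l0" using top(2) p mn by (cases "j0 = 0") auto
    with le_M[OF top(1)] show ?thesis by linarith
  qed
  define T where "T = {(j, l) \<in> supp2 P. m * j + n * l = M}"
  have T1: "(j1, l1) \<in> T" using M1 by (simp add: T_def supp2_def)
  have not_single: "T \<noteq> {(a, b)}" for a b
  proof
    assume T: "T = {(a, b)}"
    note lead = lead_single_top[OF le_M T[unfolded T_def]]
    then have "(D ^^ M) P \<noteq> 0" using D.lead_nonzero[OF lead(1)] nz by simp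
    moreover have "(D ^^ M) P = 0"
      using D.funpow_eq_0_mono[of 1 P M] M0 by (simp add: D_jac jac_self)
    ultimately show False by simp
  qed
  define Q where "Q = wtop m n (int M) P"
  have coeff_Q: "coeff2 Q j l = (if (j, l) \<in> T then coeff2 P j l else 0)" for j l
    by (simp add: Q_def coeff2_wtop T_def supp2_def del: of_nat_add of_nat_mult)
  have Q0: "coeff2 Q j l \<noteq> 0 \<longleftrightarrow> (j, l) \<in> T" for j l
    by (simp add: coeff_Q) (simp add: T_def supp2_def)
  have wle: "wle m n (int M) P"
    unfolding wle_def using le_M by (metis of_nat_le_iff)
  interpret Q: ring_derivation "jac Q" by (rule ring_derivation_jac)
  have nil_Q: "\<exists>k. (jac Q ^^ k) g = 0" for g
    unfolding Q_def by (rule wtop_jac_nilpotent[OF wle]) (use nil D_jac in simp)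
  have "Q \<noteq> 0" using Q0[of j1 l1] T1 by auto
  have factor: "jac Q x = 0" if "x dvd Q" for x
  proof -
    from that obtain y where y: "Q = x * y" by (elim dvdE)
    with \<open>Q \<noteq> 0\<close> have "y \<noteq> 0" by auto
    moreover have "jac Q (x * y) = 0" using jac_self[of Q] y by simp
    ultimately show ?thesis using Q.factor_in_kernel[OF nil_Q] by blast
  qed
  \<comment> \<open>Without a pure power of \<open>var1\<close>, the top form is divisible by
    \<open>var2\<close>, so \<open>jac Q var2 = pderiv1 Q\<close> vanishes. Then \<open>Q\<close>
    involves \<open>var2\<close> alone, and its weight fixes the exponent: a single term, which is
    excluded.\<close>
  have "\<exists>a. (a, 0) \<in> T"
  proof (rule ccontr)
    assume none: "\<not> (\<exists>a. (a, 0) \<in> T)"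
    have "var2 dvd Q"
      by (rule dvd_if_coeff2_dvd, rule var_dvd_monom2(2)) (metis Q0 none gr0I)
    from factor[OF this] have "pderiv1 Q = 0" by (simp add: jac_vars)
    then have "of_nat (Suc j) * coeff2 Q (Suc j) l = 0" for j l
      by (metis coeff2_pderiv1 coeff2_0)
    then have "coeff2 Q (Suc j) l = 0" for j l by (simp del: of_nat_Suc)
    then have j0: "j = 0" if "(j, l) \<in> T" for j l using Q0 that by (metis not0_implies_Suc)
    have "T = {(0, l1)}"
    proof (intro equalityI subsetI)
      fix x assume x: "x \<in> T"
      then obtain l where "x = (0, l)" using j0 by (cases x) auto
      then show "x \<in> {(0, l1)}" using x T1 j0[OF T1] mn by (auto simp: T_def)
    qed (use T1 j0[OF T1] in simp)
    with not_single show False by blast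
  qed
  then obtain a where a: "(a, 0) \<in> T" by blast
  have "\<exists>b. (0, b) \<in> T"
  proof (rule ccontr)
    assume none: "\<not> (\<exists>b. (0, b) \<in> T)"
    have "var1 dvd Q"
      by (rule dvd_if_coeff2_dvd, rule var_dvd_monom2(1)) (metis Q0 none gr0I)
    from factor[OF this] have "pderiv Q = 0" by (simp add: jac_vars)
    then have "of_nat (Suc l) * coeff2 Q j (Suc l) = 0" for j l
      by (metis coeff2_pderiv coeff2_0)
    then have "coeff2 Q j (Suc l) = 0" for j l by (simp del: of_nat_Suc)
    then have l0: "l = 0" if "(j, l) \<in> T" for j l using Q0 that by (metis not0_implies_Suc)
    have "T = {(j1, 0)}"
    proof (intro equalityI subsetI)
      fix x assume x: "x \<in> T"
      then obtain j where "x = (j, 0)" using l0 by (cases x) auto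
      then show "x \<in> {(j1, 0)}" using x T1 l0[OF T1] mn by (auto simp: T_def)
    qed (use T1 l0[OF T1] in simp)
    with not_single show False by blast
  qed
  then obtain b where b: "(0, b) \<in> T" by blast
  have ab: "m * a = M" "n * b = M" using a b by (auto simp: T_def)
  have "b \<le> p" using supp[of 0 b] b by (auto simp: T_def supp2_def)
  \<comment> \<open>Since \<open>m > n\<close>, a monomial of total degree \<open>p\<close> has
    weight at least \<open>n * p\<close>; hence \<open>n * b >= n * p\<close>, which with
    \<open>b <= p\<close> forces equality.\<close>
  have "n * p \<le> m * j0 + n * l0"
    using top(2) mn by (metis add_le_cancel_right distrib_left less_imp_le mult_le_mono1)
  also have "\<dots> \<le> n * b" using le_M[OF top(1)] ab by simp
  finally have "b = p" using \<open>b \<le> p\<close> mn by simp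
  then have M: "m * a = n * p" "M = n * p" using ab by auto
  have "0 < a" using M mn p by (cases a) auto
  have "a < p"
  proof (rule ccontr)
    assume "\<not> a < p"
    then have "m * p \<le> m * a" by simp
    moreover have "n * p < m * p" using mn p by simp
    ultimately show False using M by simp
  qed
  have "\<not> p dvd a" using \<open>0 < a\<close> \<open>a < p\<close> by (auto dest: dvd_imp_le)
  have "p dvd m * a" using M by simp
  then have "p dvd m" using \<open>prime p\<close> \<open>\<not> p dvd a\<close> by (simp add: prime_dvd_mult_iff)
  then obtain m' where m': "m = p * m'" by (elim dvdE)
  have n': "n = m' * a" using M(1) p unfolding m' by simp
  \<comment> \<open>With \<open>m = p * m'\<close> and \<open>n = m' * a\<close> the top line
    becomes \<open>p * j + a * l = a * p\<close>; as \<open>p\<close> does not divide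
    \<open>a\<close>, it divides \<open>l\<close>, leaving only the two endpoints.\<close>
  have T: "(j, l) = (a, 0) \<or> (j, l) = (0, p)" if "(j, l) \<in> T" for j l
  proof -
    have "m' * (p * j + a * l) = m' * (a * p)"
      using that M(2) unfolding T_def m' n' by (simp add: algebra_simps)
    moreover have "m' \<noteq> 0" using mn m' by (intro notI) simp
    ultimately have eq: "p * j + a * l = a * p" by simp
    then have "p dvd a * l" by (metis dvd_add_right_iff dvd_triv_left dvd_triv_right)
    then have "p dvd l" using \<open>prime p\<close> \<open>\<not> p dvd a\<close> by (simp add: prime_dvd_mult_iff)
    show ?thesis
    proof (cases "l = 0")
      case True
      then show ?thesis using eq p by simp
    next
      case False
      then have "p \<le> l" using \<open>p dvd l\<close> by (simp add: dvd_imp_le)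
      then have "a * p \<le> a * l" by simp
      then have "p * j = 0" "a * l = a * p" using eq by linarith+
      then show ?thesis using \<open>0 < a\<close> p by simp
    qed
  qed
  \<comment> \<open>\<open>D var2 = pderiv1 P\<close>, and of the two top monomials only
    \<open>var1 ^ a\<close> survives this derivative, so \<open>D var2\<close> has degree
    \<open>m * (a - 1)\<close>.\<close>
  have "D.lead (m * (a - 1)) (D var2) ([:[:coeff2 (D var2) (a - 1) 0:]:] * u ^ (a - 1) * v ^ 0)
    \<and> coeff2 (D var2) (a - 1) 0 \<noteq> 0"
  proof -
    have M': "m * (a - 1) + m = M" using ab \<open>0 < a\<close> by (cases a) simp_all
    have 1: "m * j + n * l \<le> m * (a - 1)" if "coeff2 (D var2) j l \<noteq> 0" for j l
      using that le_M[of "Suc j" l] M' by (auto simp: P(1)[symmetric] coeff2_pderiv1)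
    have 2: "{(j, l) \<in> supp2 (D var2). m * j + n * l = m * (a - 1)} = {(a - 1, 0)}"
    proof (intro equalityI subsetI)
      fix x assume "x \<in> {(j, l) \<in> supp2 (D var2). m * j + n * l = m * (a - 1)}"
      then obtain j l where x: "x = (j, l)" "coeff2 P (Suc j) l \<noteq> 0" "m * j + n * l = m * (a - 1)"
        by (auto simp: P(1)[symmetric] supp2_def coeff2_pderiv1)
      then have "(Suc j, l) \<in> T" using M' by (simp add: T_def supp2_def)
      with T x(1) show "x \<in> {(a - 1, 0)}" by fastforce
    next
      fix x assume "x \<in> {(a - 1, 0::nat)}"
      then show "x \<in> {(j, l) \<in> supp2 (D var2). m * j + n * l = m * (a - 1)}"
        using a \<open>0 < a\<close> by (simp add: P(1)[symmetric] supp2_def coeff2_pderiv1 T_def del: of_nat_Suc)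
    qed
    show ?thesis using lead_single_top[OF 1 2] by blast
  qed
  moreover have "D.lead (n - 1) (D var2) (of_nat n * v)"
  proof -
    obtain k where k: "n = Suc k" using mn by (metis gr0_implies_Suc)
    show ?thesis
      using v unfolding D.lead_def k
      by (simp only: diff_Suc_1 funpow_Suc_right comp_apply fact_Suc ac_simps)
  qed
  ultimately have "m * (a - 1) = n - 1"
    using D.lead_unique nz mn by fastforce
  \<comment> \<open>\<open>m * (a - 1) = n - 1 < m\<close> leaves only \<open>a = 1\<close>, hence
    \<open>M = m\<close>, and the weight bound yields the claim for every monomial.\<close>
  then have "a = 1" using mn \<open>0 < a\<close>
    by (cases "a - 1") auto
  then have "m * j + n * l \<le> m" using le_M[OF jl] ab by simp
  then show ?thesis using mn by (cases j) auto
qed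

end

section \<open>Polynomials in three variables\<close>

definition var0 :: "'k::comm_ring_1 poly3" where "var0 = [:[:[:0, 1:]:]:]"

lemma const3_0: "const3 0 = 0" and const3_1: "const3 1 = 1"
  by (simp_all add: const3_def pCons_one)

lemma const3_mult: "const3 a * const3 b = const3 (a * b)"
  by (simp add: const3_def)

lemma const3_inverse: "a \<noteq> 0 \<Longrightarrow> const3 a * (const3 (inverse a) * f) = f" for a :: "'k::field"
  by (simp add: mult.assoc[symmetric] const3_mult const3_1)

lemma const_poly2_monom: "[:[:monom a i:]:] = const3 a * var0 ^ i"
proof -
  have "[:a:] * [:0, 1:] ^ i = monom a i"
    by (simp add: monom_altdef)
  moreover have "[:[:f:]:] ^ i = [:[:f ^ i:]:]" for f :: "'a poly"
    by (induction i) (simp_all add: pCons_one)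
  ultimately show ?thesis
    by (simp add: const3_def var0_def)
qed

lemma poly3_monom_induct:
  fixes f :: "'k::comm_ring_1 poly3"
  assumes monom: "\<And>i j l. coeff (coeff2 f j l) i \<noteq> 0 \<Longrightarrow>
      P (const3 (coeff (coeff2 f j l) i) * var0 ^ i * var1 ^ j * var2 ^ l)"
    and zero: "P 0" and add: "\<And>f g. P f \<Longrightarrow> P g \<Longrightarrow> P (f + g)"
  shows "P f"
proof (rule poly2_monom_induct[where g = f])
  fix j l
  define c where "c = coeff2 f j l"
  have "P (monom2 (\<Sum>i\<in>A. monom (coeff c i) i) j l)" if "finite A" for A
    using that
  proof (induction A rule: finite_induct)
    case empty
    then show ?case by (simp add: monom2_def zero)
  next
    case (insert i A)
    have "P (monom2 (monom (coeff c i) i) j l)"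
    proof (cases "coeff c i = 0")
      case True
      then show ?thesis by (simp add: monom2_def zero)
    next
      case False
      then show ?thesis using monom[of j l i] by (simp add: c_def monom2_eq const_poly2_monom)
    qed
    from add[OF this insert.IH] show ?case
      using insert by (simp add: monom2_def add_monom)
  qed
  from this[of "{..degree c}"] show "P (monom2 (coeff2 f j l) j l)"
    by (simp add: poly_as_sum_of_monoms c_def)
qed (use zero add in auto)

lemma adjoin_power: "x \<in> adjoin S \<Longrightarrow> x ^ n \<in> adjoin S"
  using adjoin.const[of 1 S] by (induction n) (auto simp: const3_1 intro: adjoin.mult)

text \<open>Reduces membership in a subalgebra to the monomials that occur; this is how the
  triangular shape is read off from the support of \<open>P\<close>.\<close>

lemma adjoin_coeffs:
  assumes "\<And>i j l. coeff (coeff2 f j l) i \<noteq> 0 \<Longrightarrow> var0 ^ i * var1 ^ j * var2 ^ l \<in> adjoin S"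
  shows "f \<in> adjoin S"
  by (rule poly3_monom_induct)
    (use assms adjoin.const[of 0 S] in \<open>auto simp: const3_0 mult.assoc intro: adjoin.intros\<close>)

lemma adjoin_vars: "adjoin {var0, var1, var2} = UNIV"
proof -
  have "f \<in> adjoin {var0, var1, var2}" for f :: "'a poly3"
    by (rule adjoin_coeffs, intro adjoin.mult adjoin_power adjoin.gen) simp_all
  then show ?thesis by auto
qed

section \<open>The standard grading\<close>

lemma homogeneous_component_iff:
  "f \<in> homogeneous_component n \<longleftrightarrow> (\<forall>i j l. coeff (coeff2 f j l) i \<noteq> 0 \<longrightarrow> int (i + j + l) = n)"
  by (simp add: homogeneous_component_def coeff2_def)

lemma homogeneous_component_0: "0 \<in> homogeneous_component n"
  by (simp add: homogeneous_component_iff)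

lemma homogeneous_component_add:
  "f \<in> homogeneous_component n \<Longrightarrow> g \<in> homogeneous_component n \<Longrightarrow> f + g \<in> homogeneous_component n"
  unfolding homogeneous_component_iff coeff2_add coeff_add by (metis add_0)

lemma homogeneous_component_minus:
  "f \<in> homogeneous_component n \<Longrightarrow> - f \<in> homogeneous_component n"
  by (simp add: homogeneous_component_iff)

lemma homogeneous_component_diff:
  "f \<in> homogeneous_component n \<Longrightarrow> g \<in> homogeneous_component n \<Longrightarrow> f - g \<in> homogeneous_component n"
  using homogeneous_component_add[OF _ homogeneous_component_minus] by fastforce

lemma homogeneous_component_mult:
  assumes f: "f \<in> homogeneous_component m" and g: "g \<in> homogeneous_component n"
  shows "f * g \<in> homogeneous_component (m + n)"
  unfolding homogeneous_component_iff
proof (intro allI impI)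
  fix i j l assume "coeff (coeff2 (f * g) j l) i \<noteq> 0"
  then have "(\<Sum>l'\<le>l. \<Sum>j'\<le>j. \<Sum>i'\<le>i. coeff (coeff2 f j' l') i' * coeff (coeff2 g (j - j') (l - l')) (i - i')) \<noteq> 0"
    by (simp add: coeff2_mult coeff_sum coeff_mult)
  then obtain l' j' i' where le: "l' \<le> l" "j' \<le> j" "i' \<le> i"
    and nz: "coeff (coeff2 f j' l') i' * coeff (coeff2 g (j - j') (l - l')) (i - i') \<noteq> 0"
    by (meson atMost_iff sum.not_neutral_contains_not_neutral)
  then have "coeff (coeff2 f j' l') i' \<noteq> 0" "coeff (coeff2 g (j - j') (l - l')) (i - i') \<noteq> 0"
    by auto
  then have "int (i' + j' + l') = m" "int ((i - i') + (j - j') + (l - l')) = n"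
    using f g unfolding homogeneous_component_iff by blast+
  then show "int (i + j + l) = m + n" using le by simp
qed

lemma homogeneous_component_const3: "const3 c \<in> homogeneous_component 0"
  unfolding homogeneous_component_def const3_def by (simp add: coeff_pCons split: nat.splits)

lemma homogeneous_component_var:
  "var0 \<in> homogeneous_component 1" "var1 \<in> homogeneous_component 1" "var2 \<in> homogeneous_component 1"
  unfolding homogeneous_component_def var0_def var1_def var2_def one_pCons
  by (simp_all add: coeff_pCons split: nat.splits)

lemma homogeneous_component_power:
  "f \<in> homogeneous_component 1 \<Longrightarrow> f ^ n \<in> homogeneous_component (int n)"
proof (induction n)
  case 0
  then show ?case using homogeneous_component_const3[of 1] by (simp add: const3_1)
next
  case (Suc n)
  then show ?case using homogeneous_component_mult[of f 1 "f ^ n" "int n"] by (simp add: algebra_simps)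
qed

lemma homogeneous_component_monom:
  assumes "x \<in> homogeneous_component 1" "y \<in> homogeneous_component 1" "z \<in> homogeneous_component 1"
  shows "const3 c * x ^ i * y ^ j * z ^ l \<in> homogeneous_component (int (i + j + l))"
  using homogeneous_component_mult[OF homogeneous_component_mult[OF homogeneous_component_mult[OF
        homogeneous_component_const3 homogeneous_component_power[OF assms(1)]]
      homogeneous_component_power[OF assms(2)]] homogeneous_component_power[OF assms(3)]]
  by simp

lemma homogeneous_component_scale:
  "f \<in> homogeneous_component n \<Longrightarrow> const3 c * f \<in> homogeneous_component n"
  using homogeneous_component_mult[OF homogeneous_component_const3] by fastforce

section \<open>Algebra endomorphisms and the universal property of the polynomial ring\<close>

definition alg_hom :: "('k::comm_ring_1 poly3 \<Rightarrow> 'k poly3) \<Rightarrow> bool" where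
  "alg_hom \<phi> \<longleftrightarrow> (\<forall>f g. \<phi> (f + g) = \<phi> f + \<phi> g) \<and> (\<forall>f g. \<phi> (f * g) = \<phi> f * \<phi> g) \<and>
    (\<forall>c. \<phi> (const3 c) = const3 c)"

lemma alg_homD:
  assumes "alg_hom \<phi>"
  shows "\<phi> (f + g) = \<phi> f + \<phi> g" "\<phi> (f * g) = \<phi> f * \<phi> g" "\<phi> (const3 c) = const3 c"
    "\<phi> 0 = 0" "\<phi> 1 = 1" "\<phi> (f ^ n) = \<phi> f ^ n" "\<phi> (- f) = - \<phi> f" "\<phi> (f - g) = \<phi> f - \<phi> g"
proof -
  show *: "\<phi> (f + g) = \<phi> f + \<phi> g" "\<phi> (f * g) = \<phi> f * \<phi> g" "\<phi> (const3 c) = const3 c" for f g c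
    using assms by (simp_all add: alg_hom_def)
  show "\<phi> 0 = 0" "\<phi> 1 = 1" using *(3)[of 0] *(3)[of 1] by (simp_all add: const3_0 const3_1)
  then show "\<phi> (f ^ n) = \<phi> f ^ n" by (induction n) (simp_all add: *)
  show minus: "\<phi> (- f) = - \<phi> f" for f
    using *(1)[of f "- f"] \<open>\<phi> 0 = 0\<close> by (simp add: eq_neg_iff_add_eq_0 add.commute)
  show "\<phi> (f - g) = \<phi> f - \<phi> g" using *(1)[of f "- g"] minus[of g] by simp
qed

lemma alg_hom_comp: "alg_hom \<phi> \<Longrightarrow> alg_hom \<psi> \<Longrightarrow> alg_hom (\<phi> \<circ> \<psi>)"
  by (simp add: alg_hom_def)

lemma alg_hom_adjoin: "x \<in> adjoin S \<Longrightarrow> alg_hom \<phi> \<Longrightarrow> \<phi> x \<in> adjoin (\<phi> ` S)"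
  by (induction rule: adjoin.induct) (auto simp: alg_homD intro: adjoin.intros)

lemma alg_hom_eq_id:
  assumes "alg_hom \<phi>" "\<phi> var0 = var0" "\<phi> var1 = var1" "\<phi> var2 = var2"
  shows "\<phi> f = f"
proof -
  have "f \<in> adjoin {var0, var1, var2}" by (simp add: adjoin_vars)
  then show ?thesis by (induction rule: adjoin.induct) (use assms in \<open>auto simp: alg_homD\<close>)
qed

lemma alg_hom_homogeneous:
  assumes "alg_hom \<phi>" "\<phi> var0 \<in> homogeneous_component 1" "\<phi> var1 \<in> homogeneous_component 1"
    "\<phi> var2 \<in> homogeneous_component 1" and f: "f \<in> homogeneous_component n"
  shows "\<phi> f \<in> homogeneous_component n"
proof (rule poly3_monom_induct[of f "\<lambda>f. \<phi> f \<in> homogeneous_component n"])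
  fix i j l assume "coeff (coeff2 f j l) i \<noteq> 0"
  then have "int (i + j + l) = n" using f by (simp add: homogeneous_component_iff)
  then show "\<phi> (const3 (coeff (coeff2 f j l) i) * var0 ^ i * var1 ^ j * var2 ^ l) \<in> homogeneous_component n"
    using homogeneous_component_monom[OF assms(2-4)] by (auto simp: alg_homD[OF assms(1)])
qed (simp_all add: alg_homD[OF assms(1)] homogeneous_component_0 homogeneous_component_add)

definition eval_poly_hom :: "('a::comm_ring_1 \<Rightarrow> 'b::comm_ring_1) \<Rightarrow> 'b \<Rightarrow> 'a poly \<Rightarrow> 'b" where
  "eval_poly_hom h x f = poly (map_poly h f) x"

lemma eval_poly_hom:
  assumes h: "\<And>a b. h (a + b) = h a + h b" "\<And>a b. h (a * b) = h a * h b" "h 1 = 1"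
  shows "eval_poly_hom h x (f + g) = eval_poly_hom h x f + eval_poly_hom h x g"
    and "eval_poly_hom h x (f * g) = eval_poly_hom h x f * eval_poly_hom h x g"
    and "eval_poly_hom h x [:a:] = h a" and "eval_poly_hom h x [:0, 1:] = x"
    and "eval_poly_hom h x 1 = 1"
proof -
  have h0: "h 0 = 0" using h(1)[of 0 0] by simp
  have h_sum: "h (sum s A) = (\<Sum>y\<in>A. h (s y))" if "finite A" for s :: "nat \<Rightarrow> 'a" and A
    using that by (induction A rule: finite_induct) (simp_all add: h h0)
  have "map_poly h (f + g) = map_poly h f + map_poly h g"
    by (rule poly_eqI) (simp add: coeff_map_poly h h0)
  then show "eval_poly_hom h x (f + g) = eval_poly_hom h x f + eval_poly_hom h x g"
    by (simp add: eval_poly_hom_def)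
  have "map_poly h (f * g) = map_poly h f * map_poly h g"
    by (rule poly_eqI) (simp add: coeff_map_poly coeff_mult h h0 h_sum)
  then show "eval_poly_hom h x (f * g) = eval_poly_hom h x f * eval_poly_hom h x g"
    by (simp add: eval_poly_hom_def)
qed (simp_all add: eval_poly_hom_def map_poly_pCons map_poly_1 h h(1)[of 0 0, simplified])

lemma ex_alg_hom:
  "\<exists>\<phi>. alg_hom \<phi> \<and> \<phi> var0 = a \<and> \<phi> var1 = b \<and> \<phi> (var2 :: 'k::comm_ring_1 poly3) = c"
proof -
  define \<phi>0 where "\<phi>0 = eval_poly_hom const3 a"
  define \<phi>1 where "\<phi>1 = eval_poly_hom \<phi>0 b"
  define \<phi>2 where "\<phi>2 = eval_poly_hom \<phi>1 c"
  have const3: "const3 (x + y) = const3 x + const3 y" "const3 (x * y) = const3 x * const3 y" for x y :: 'k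
    by (simp_all add: const3_def)
  note h0 = eval_poly_hom[of const3 a, OF const3 const3_1, folded \<phi>0_def]
  note h1 = eval_poly_hom[of \<phi>0 b, OF h0(1,2,5), folded \<phi>1_def]
  note h2 = eval_poly_hom[of \<phi>1 c, OF h1(1,2,5), folded \<phi>2_def]
  have "alg_hom \<phi>2"
    unfolding alg_hom_def using h2(1,2) by (simp add: const3_def h0 h1 h2)
  moreover have "\<phi>2 var0 = a" "\<phi>2 var1 = b" "\<phi>2 var2 = c"
    by (simp_all add: var0_def var1_def var2_def h0 h1 h2)
  ultimately show ?thesis by blast
qed

section \<open>Homogeneous derivations killing a variable\<close>

text \<open>A nonzero polynomial over a domain has finitely many roots, but there are infinitely
  many constants; the variables are removed one at a time.\<close>

lemma poly3_eq_0_if_vanishes: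
  fixes f :: "'k::field_char_0 poly3"
  assumes "\<And>z y x. poly (poly (poly f [:[:z:]:]) [:y:]) x = 0"
  shows "f = 0"
proof -
  have const: "g = 0" if "\<And>c. poly g [:c:] = 0" for g :: "'b::{idom,ring_char_0} poly poly"
  proof (rule ccontr)
    assume "g \<noteq> 0"
    then have "finite {x. poly g x = 0}" by (rule poly_roots_finite)
    moreover have "range (\<lambda>c. [:c:]) \<subseteq> {x. poly g x = 0}" using that by auto
    ultimately have "finite (range (\<lambda>c::'b. [:c:]))" by (rule finite_subset[rotated])
    then have "finite (UNIV :: 'b set)" by (rule finite_imageD) (simp add: inj_def)
    then show False using infinite_UNIV_char_0 by blast
  qed
  have "poly (poly f [:[:z:]:]) [:y:] = 0" for z y
    using assms poly_all_0_iff_0 by blast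
  then have *: "poly f [:[:z:]:] = 0" for z using const by blast
  show ?thesis
  proof (rule ccontr)
    assume "f \<noteq> 0"
    then have "finite {x. poly f x = 0}" by (rule poly_roots_finite)
    moreover have "range (\<lambda>c. [:[:c:]:]) \<subseteq> {x. poly f x = 0}" using * by auto
    ultimately have "finite (range (\<lambda>c::'k. [:[:c:]:]))" by (rule finite_subset[rotated])
    then have "finite (UNIV :: 'k set)" by (rule finite_imageD) (simp add: inj_def)
    then show False using infinite_UNIV_char_0 by blast
  qed
qed

text \<open>A root in the field of fractions of a form with coefficients in \<open>k\<close> takes, at the points
  where it is defined, only finitely many values. So it is constant.\<close>

lemma homogeneous_relation_proportional:
  fixes u v :: "'k::field_char_0 poly3"
  assumes "finite S" and deg: "\<And>x. x \<in> S \<Longrightarrow> fst x + snd x = p"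
    and x0: "x0 \<in> S" "k x0 \<noteq> 0" and u: "u \<noteq> 0"
    and rel: "(\<Sum>x\<in>S. const3 (k x) * u ^ fst x * v ^ snd x) = 0"
  shows "\<exists>c. v = const3 c * u"
proof -
  \<comment> \<open>The relation dehomogenized at \<open>t = v / u\<close>. As
    \<open>fst x + snd x = p\<close> on \<open>S\<close>, distinct indices give distinct powers of
    \<open>t\<close>, so no coefficient is lost and \<open>q\<close> is nonzero.\<close>
  define q where "q = (\<Sum>x\<in>S. monom (k x) (snd x))"
  have "coeff q (snd x0) = (\<Sum>x\<in>S. if x = x0 then k x0 else 0)"
    unfolding q_def coeff_sum
  proof (intro sum.cong refl)
    fix x assume "x \<in> S"
    then have "snd x = snd x0 \<longleftrightarrow> x = x0"
      using deg[of x] deg[OF x0(1)] by (auto simp: prod_eq_iff)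
    then show "coeff (monom (k x) (snd x)) (snd x0) = (if x = x0 then k x0 else 0)"
      by auto
  qed
  also have "\<dots> = k x0" using assms(1) x0(1) sum.delta[of S x0 "\<lambda>_. k x0"] by simp
  finally have "q \<noteq> 0" using x0(2) by auto
  define R where "R = {r. poly q r = 0}"
  have "finite R" unfolding R_def using \<open>q \<noteq> 0\<close> by (rule poly_roots_finite)
  \<comment> \<open>At every point either \<open>u\<close> vanishes or \<open>v / u\<close> is one
    of the finitely many roots of \<open>q\<close>. In a domain some factor must then vanish
    identically.\<close>
  have "u * (\<Prod>r\<in>R. v - const3 r * u) = 0"
  proof (rule poly3_eq_0_if_vanishes)
    fix z y x
    define ev where "ev f = poly (poly (poly f [:[:z:]:]) [:y:]) x" for f :: "'k poly3"
    have ev: "ev (f + g) = ev f + ev g" "ev (f - g) = ev f - ev g" "ev (f * g) = ev f * ev g"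
      "ev (f ^ n) = ev f ^ n" "ev (const3 c) = c" "ev (sum h A) = (\<Sum>i\<in>A. ev (h i))"
      "ev (prod h A) = (\<Prod>i\<in>A. ev (h i))" for f g n c h and A :: "'b set"
      by (simp_all add: ev_def const3_def poly_sum poly_prod)
    show "poly (poly (poly (u * (\<Prod>r\<in>R. v - const3 r * u)) [:[:z:]:]) [:y:]) x = 0"
    proof (cases "ev u = 0")
      case True
      then show ?thesis by (simp add: ev_def)
    next
      case False
      define t where "t = ev v / ev u"
      have "0 = ev (\<Sum>x\<in>S. const3 (k x) * u ^ fst x * v ^ snd x)"
        unfolding rel by (simp add: ev_def)
      also have "\<dots> = (\<Sum>x\<in>S. k x * ev u ^ fst x * ev v ^ snd x)"
        by (simp add: ev)
      also have "\<dots> = (\<Sum>x\<in>S. ev u ^ p * (k x * t ^ snd x))"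
      proof (intro sum.cong refl)
        fix x assume "x \<in> S"
        have "ev v = t * ev u" using False by (simp add: t_def)
        then show "k x * ev u ^ fst x * ev v ^ snd x = ev u ^ p * (k x * t ^ snd x)"
          unfolding deg[OF \<open>x \<in> S\<close>, symmetric] by (simp add: power_mult_distrib power_add)
      qed
      also have "\<dots> = ev u ^ p * poly q t"
        by (simp add: q_def poly_sum poly_monom sum_distrib_left)
      finally have "t \<in> R" using False by (simp add: R_def)
      moreover have "ev v - t * ev u = 0" using False by (simp add: t_def)
      ultimately have "(\<Prod>r\<in>R. ev v - r * ev u) = 0" using \<open>finite R\<close> by auto
      then have "ev (u * (\<Prod>r\<in>R. v - const3 r * u)) = 0" by (simp add: ev)
      then show ?thesis by (simp add: ev_def)
    qed
  qed
  then have "\<exists>r\<in>R. v - const3 r * u = 0" using u \<open>finite R\<close> by simp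
  then show ?thesis by auto
qed

text \<open>Working form of the hypotheses, stable under graded automorphisms. Irreducibility
  becomes a condition on common divisors of the image; with \<open>a = 0\<close> it excludes
  \<open>D = 0\<close>.\<close>

definition irreducible_homogeneous_lnd :: "('k::field_char_0 poly3 \<Rightarrow> 'k poly3) \<Rightarrow> int \<Rightarrow> bool" where
  "irreducible_homogeneous_lnd D d \<longleftrightarrow> ring_derivation D \<and> (\<forall>c. D (const3 c) = 0) \<and>
    (\<forall>f. \<exists>n. (D ^^ n) f = 0) \<and>
    (\<forall>e. \<forall>f\<in>homogeneous_component e. D f \<in> homogeneous_component (e + d)) \<and>
    (\<forall>a. (\<forall>f. a dvd D f) \<longrightarrow> a dvd 1)"

lemma irreducible_homogeneous_lndD:
  assumes "irreducible_homogeneous_lnd D d"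
  shows "ring_derivation D" "D (const3 c) = 0" "\<exists>n. (D ^^ n) f = 0"
    "f \<in> homogeneous_component e \<Longrightarrow> D f \<in> homogeneous_component (e + d)"
    "(\<And>f. a dvd D f) \<Longrightarrow> a dvd 1"
  using assms by (auto simp: irreducible_homogeneous_lnd_def)

text \<open>Mutually inverse graded automorphisms, i.e. invertible linear changes of the three
  variables.\<close>

definition graded_inverses :: "('k::field_char_0 poly3 \<Rightarrow> 'k poly3) \<Rightarrow> ('k poly3 \<Rightarrow> 'k poly3) \<Rightarrow> bool" where
  "graded_inverses \<phi> \<psi> \<longleftrightarrow> alg_hom \<phi> \<and> alg_hom \<psi> \<and> (\<forall>f. \<phi> (\<psi> f) = f) \<and> (\<forall>f. \<psi> (\<phi> f) = f) \<and>
    (\<forall>e. \<forall>f\<in>homogeneous_component e. \<phi> f \<in> homogeneous_component e) \<and>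
    (\<forall>e. \<forall>f\<in>homogeneous_component e. \<psi> f \<in> homogeneous_component e)"

lemma graded_inversesI:
  assumes \<phi>: "alg_hom \<phi>" and \<psi>: "alg_hom \<psi>"
    and "\<And>x. x \<in> {var0, var1, var2} \<Longrightarrow> \<phi> x \<in> homogeneous_component 1"
    and "\<And>x. x \<in> {var0, var1, var2} \<Longrightarrow> \<psi> x \<in> homogeneous_component 1"
    and "\<And>x. x \<in> {var0, var1, var2} \<Longrightarrow> \<phi> (\<psi> x) = x"
    and "\<And>x. x \<in> {var0, var1, var2} \<Longrightarrow> \<psi> (\<phi> x) = x"
  shows "graded_inverses \<phi> \<psi>"
  unfolding graded_inverses_def
  using assms alg_hom_eq_id[OF alg_hom_comp[OF \<phi> \<psi>]] alg_hom_eq_id[OF alg_hom_comp[OF \<psi> \<phi>]]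
    alg_hom_homogeneous[OF \<phi>] alg_hom_homogeneous[OF \<psi>]
  by simp

lemma funpow_conjugate:
  "(\<And>f. \<phi> (\<psi> f) = f) \<Longrightarrow> (\<And>f. \<psi> (\<phi> f) = f) \<Longrightarrow> ((\<lambda>f. \<psi> (D (\<phi> f))) ^^ n) f = \<psi> ((D ^^ n) (\<phi> f))"
  by (induction n) simp_all

lemma irreducible_homogeneous_lnd_conjugate:
  assumes D: "irreducible_homogeneous_lnd D d" and "graded_inverses \<phi> \<psi>"
  shows "irreducible_homogeneous_lnd (\<lambda>f. \<psi> (D (\<phi> f))) d"
proof -
  interpret D: ring_derivation D by (rule irreducible_homogeneous_lndD[OF D])
  have \<phi>: "alg_hom \<phi>" and \<psi>: "alg_hom \<psi>" and inv: "\<And>f. \<phi> (\<psi> f) = f" "\<And>f. \<psi> (\<phi> f) = f"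
    using assms(2) by (auto simp: graded_inverses_def)
  have h1: "ring_derivation (\<lambda>f. \<psi> (D (\<phi> f)))"
    by unfold_locales (simp_all add: alg_homD[OF \<phi>] alg_homD[OF \<psi>] D.add D.mult inv)
  have h2: "\<psi> (D (\<phi> (const3 c))) = 0" for c
    by (simp add: alg_homD[OF \<phi>] alg_homD[OF \<psi>] irreducible_homogeneous_lndD[OF D])
  have h3: "\<exists>n. ((\<lambda>f. \<psi> (D (\<phi> f))) ^^ n) f = 0" for f
    unfolding funpow_conjugate[OF inv] using irreducible_homogeneous_lndD(3)[OF D, of "\<phi> f"]
    by (metis alg_homD(4)[OF \<psi>])
  have h4: "\<psi> (D (\<phi> f)) \<in> homogeneous_component (e + d)" if "f \<in> homogeneous_component e" for f e
  proof -
    have "\<phi> f \<in> homogeneous_component e" using that assms(2) by (simp add: graded_inverses_def)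
    then have "D (\<phi> f) \<in> homogeneous_component (e + d)" by (rule irreducible_homogeneous_lndD(4)[OF D])
    then show ?thesis using assms(2) by (simp add: graded_inverses_def)
  qed
  \<comment> \<open>A common divisor of the conjugate's image is moved by \<open>\<phi>\<close> to
    one of the image of \<open>D\<close>, and the resulting unit is moved back by
    \<open>\<psi>\<close>.\<close>
  have h5: "a dvd 1" if "\<And>f. a dvd \<psi> (D (\<phi> f))" for a
  proof -
    have dvd: "\<phi> b dvd \<phi> c" if "b dvd c" for b c
      using that by (auto simp: dvd_def alg_homD[OF \<phi>])
    have "\<phi> a dvd D f" for f using dvd[OF that[of "\<psi> f"]] by (simp add: inv)
    then have "\<phi> a dvd 1" by (rule irreducible_homogeneous_lndD(5)[OF D])
    then obtain b where "1 = \<phi> a * b" by (elim dvdE)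
    then have "\<psi> 1 = \<psi> (\<phi> a * b)" by simp
    then have "1 = a * \<psi> b" by (simp only: alg_homD(2,5)[OF \<psi>] inv)
    then show ?thesis by (rule dvdI)
  qed
  show ?thesis
    unfolding irreducible_homogeneous_lnd_def by (intro conjI allI ballI impI h1 h2 h3 h4 h5) auto
qed

lemma triangularizable_conjugate:
  fixes D :: "'k::field_char_0 poly3 \<Rightarrow> 'k poly3"
  assumes "graded_inverses \<phi> \<psi>" "triangularizable (\<lambda>f. \<psi> (D (\<phi> f)))"
  shows "triangularizable D"
proof -
  have \<phi>: "alg_hom \<phi>" and \<psi>: "alg_hom \<psi>" and inv: "\<And>f. \<phi> (\<psi> f) = f" "\<And>f. \<psi> (\<phi> f) = f"
    using assms(1) by (auto simp: graded_inverses_def)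
  obtain X :: "nat \<Rightarrow> 'k poly3" where X: "adjoin {X 1, X 2, X 3} = UNIV" "\<psi> (D (\<phi> (X 1))) \<in> range const3"
    "\<psi> (D (\<phi> (X 2))) \<in> adjoin {X 1}" "\<psi> (D (\<phi> (X 3))) \<in> adjoin {X 1, X 2}"
    using assms(2) unfolding triangularizable_def coordinate_system_def by (elim exE conjE) (rule that)
  have "\<phi> (\<psi> f) \<in> adjoin (\<phi> ` {X 1, X 2, X 3})" for f
    by (rule alg_hom_adjoin[OF _ \<phi>]) (simp only: X(1) UNIV_I)
  then have "adjoin {\<phi> (X 1), \<phi> (X 2), \<phi> (X 3)} = UNIV"
    by (intro equalityI subset_UNIV subsetI) (simp add: inv)
  moreover have "D (\<phi> (X 1)) \<in> range const3"
  proof -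
    from X(2) obtain c where "\<psi> (D (\<phi> (X 1))) = const3 c" by (elim rangeE)
    from arg_cong[OF this, of \<phi>] show ?thesis by (simp add: inv alg_homD(3)[OF \<phi>])
  qed
  moreover have "D (\<phi> (X 2)) \<in> adjoin {\<phi> (X 1)}"
    using alg_hom_adjoin[OF X(3) \<phi>] by (simp add: inv)
  moreover have "D (\<phi> (X 3)) \<in> adjoin {\<phi> (X 1), \<phi> (X 2)}"
    using alg_hom_adjoin[OF X(4) \<phi>] by (simp add: inv)
  ultimately show ?thesis
    unfolding triangularizable_def coordinate_system_def
    by (intro exI[of _ "\<lambda>i. \<phi> (X i)"] conjI)
qed

lemma poly_dvd_1_of_nat: "(of_nat (Suc n) :: 'k::field_char_0 poly) dvd 1"
proof
  show "(1 :: 'k poly) = of_nat (Suc n) * [:inverse (of_nat (Suc n)):]"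
    by (simp add: of_nat_poly pCons_one del: of_nat_Suc)
qed

text \<open>\<open>D U = 0\<close> makes \<open>D\<close> linear over \<open>k[U]\<close>, so the
  two-variable results apply with coefficient ring \<open>k[U]\<close>.\<close>

lemma const_poly2_in_kernel:
  assumes D: "irreducible_homogeneous_lnd D d" and "D var0 = 0"
  shows "D [:[:c:]:] = 0"
proof -
  interpret D: ring_derivation D by (rule irreducible_homogeneous_lndD[OF D])
  have monom: "D [:[:monom a i:]:] = 0" for a i
    by (simp add: const_poly2_monom D.mult irreducible_homogeneous_lndD(2)[OF D] D.power_const assms(2))
  have "D [:[:\<Sum>i\<in>A. monom (coeff c i) i:]:] = 0" if "finite A" for A
    using that
  proof (induction A rule: finite_induct)
    case (insert i A)
    then show ?case using D.add[of "[:[:monom (coeff c i) i:]:]" "[:[:\<Sum>i\<in>A. monom (coeff c i) i:]:]"] monom by simp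
  qed simp
  from this[of "{..degree c}"] show ?thesis by (simp add: poly_as_sum_of_monoms)
qed

text \<open>Zero divergence gives \<open>P\<close>. Since \<open>D V\<close> and \<open>D W\<close>
  are forms of degree \<open>p - 1\<close>, the terms of \<open>P\<close> have degree
  \<open>p\<close>, apart from the part in \<open>k[U]\<close>, which the derivatives do not see. A
  term of degree \<open>p\<close> in \<open>V\<close> and \<open>W\<close> alone exists because
  otherwise \<open>U\<close> would divide the image of \<open>D\<close>.\<close>

lemma homogeneous_potential:
  assumes D: "irreducible_homogeneous_lnd D (int p - 2)" and "D var0 = 0" and p: "p \<ge> 2"
  obtains P where "pderiv1 P = D var2" "pderiv P = - D var1"
    and "\<And>i j l. coeff (coeff2 P j l) i \<noteq> 0 \<Longrightarrow> (j = 0 \<and> l = 0) \<or> i + j + l = p"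
    and "\<exists>j l. j + l = p \<and> coeff2 P j l \<noteq> 0"
proof -
  interpret D: ring_derivation D by (rule irreducible_homogeneous_lndD[OF D])
  note const = const_poly2_in_kernel[OF D \<open>D var0 = 0\<close>]
  have eq: "D g = pderiv1 g * D var1 + pderiv g * D var2" for g
    by (rule derivation_eq_pderiv[OF D.ring_derivation_axioms const])
  have "pderiv1 (D var1) + pderiv (D var2) = 0"
    by (rule divergence_eq_0[OF D.ring_derivation_axioms ring_derivation_pderiv1 ring_derivation_pderiv
          pderiv1_pderiv eq pderiv_vars(1,3,2,4) irreducible_homogeneous_lndD(3)[OF D]])
  then obtain P where P: "pderiv1 P = D var2" "pderiv P = - D var1"
    using divergence_free_eq_jacobian[OF poly_dvd_1_of_nat] by blast
  have hom: "i + j + l = p - 1" if "coeff (coeff2 (D x) j l) i \<noteq> 0" "x \<in> {var1, var2}" for i j l x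
  proof -
    have "D x \<in> homogeneous_component (1 + (int p - 2))"
      using that(2) homogeneous_component_var by (intro irreducible_homogeneous_lndD(4)[OF D]) auto
    then have "int (i + j + l) = 1 + (int p - 2)"
      using that(1) unfolding homogeneous_component_iff by blast
    then show ?thesis using p by linarith
  qed
  have of_nat_coeff: "coeff (of_nat n * f) i = of_nat n * coeff f i" for n i and f :: "'a poly"
    by (simp add: of_nat_poly)
  have cP1: "of_nat (Suc j) * coeff (coeff2 P (Suc j) l) i = coeff (coeff2 (D var2) j l) i" for i j l
    unfolding P(1)[symmetric] coeff2_pderiv1 of_nat_coeff ..
  have cP2: "of_nat (Suc l) * coeff (coeff2 P j (Suc l)) i = - coeff (coeff2 (D var1) j l) i" for i j l
    using arg_cong[OF P(2), of "\<lambda>g. coeff (coeff2 g j l) i"]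
    by (simp only: coeff2_pderiv of_nat_coeff coeff2_minus coeff_minus)
  have deg: "(j = 0 \<and> l = 0) \<or> i + j + l = p" if "coeff (coeff2 P j l) i \<noteq> 0" for i j l
  proof (cases j)
    case (Suc j')
    then have "coeff (coeff2 (D var2) j' l) i \<noteq> 0"
      using cP1[of j' l i, symmetric] that by (simp del: of_nat_Suc)
    from hom[OF this] show ?thesis using Suc p by simp
  next
    case 0
    show ?thesis
    proof (cases l)
      case (Suc l')
      then have "- coeff (coeff2 (D var1) j l') i \<noteq> 0"
        using cP2[of l' j i, symmetric] that by (simp del: of_nat_Suc)
      then have "coeff (coeff2 (D var1) j l') i \<noteq> 0" by simp
      from hom[OF this] show ?thesis using Suc p by simp
    qed (use 0 in simp)
  qed
  have "\<exists>j l. j + l = p \<and> coeff2 P j l \<noteq> 0"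
  proof (rule ccontr)
    assume none: "\<not> (\<exists>j l. j + l = p \<and> coeff2 P j l \<noteq> 0)"
    \<comment> \<open>A monomial of \<open>D V\<close> or \<open>D W\<close> free of
      \<open>U\<close> would come from a monomial of \<open>P\<close> of degree \<open>p\<close> in
      \<open>V\<close> and \<open>W\<close> alone.\<close>
    have top: "coeff (coeff2 (D x) j l) 0 = 0" if x: "x \<in> {var1, var2}" for x j l
    proof (rule ccontr)
      assume nz: "coeff (coeff2 (D x) j l) 0 \<noteq> 0"
      from hom[OF nz x] have "Suc j + l = p" "j + Suc l = p" using p by auto
      then have "coeff2 P (Suc j) l = 0" "coeff2 P j (Suc l) = 0" using none by blast+
      then show False using cP1[of j l 0] cP2[of l j 0] nz x by auto
    qed
    have "var0 dvd D x" if x: "x \<in> {var1, var2}" for x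
    proof (rule dvd_if_coeff2_dvd)
      fix j l
      obtain q where "coeff2 (D x) j l = [:0, 1:] * q"
        using top[OF x, of j l] by (cases "coeff2 (D x) j l") auto
      then have "monom2 (coeff2 (D x) j l) j l = var0 * monom2 q j l"
        by (simp add: monom2_eq var0_def)
      then show "var0 dvd monom2 (coeff2 (D x) j l) j l" by simp
    qed
    then have "var0 dvd D f" for f unfolding eq[of f] by simp
    then have "var0 dvd (1 :: 'a poly3)" by (rule irreducible_homogeneous_lndD(5)[OF D])
    then obtain b :: "'a poly3" where "1 = var0 * b" by (elim dvdE)
    from arg_cong[OF this, of "\<lambda>g. coeff (coeff2 g 0 0) 0"] show False
      by (simp add: var0_def coeff2_def)
  qed
  with P deg that show thesis by blast
qed

lemma ex_lead:
  fixes D :: "'k::field_char_0 poly3 \<Rightarrow> 'k poly3"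
  assumes D: "irreducible_homogeneous_lnd D d" and "f \<noteq> 0"
  obtains m u where "ring_derivation.lead D m f u" "u \<noteq> 0"
proof -
  interpret D: ring_derivation D by (rule irreducible_homogeneous_lndD[OF D])
  obtain k where "(D ^^ k) f = 0" using irreducible_homogeneous_lndD(3)[OF D] by blast
  then obtain m where m: "(D ^^ m) f \<noteq> 0" "(D ^^ Suc m) f = 0"
    using D.funpow_degree \<open>f \<noteq> 0\<close> by metis
  define u where "u = const3 (inverse (fact m)) * (D ^^ m) f"
  have "fact m = const3 (fact m :: 'k)"
  proof -
    have "of_nat n = const3 (of_nat n :: 'k)" for n
      by (simp add: const3_def of_nat_poly)
    from this[of "fact m"] show ?thesis by simp
  qed
  then have "fact m * u = (D ^^ m) f"
    by (simp add: u_def const3_inverse)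
  then have "D.lead m f u" "u \<noteq> 0" using m by (auto simp: D.lead_def)
  then show thesis by (rule that)
qed

text \<open>\<open>deg\<close> says that \<open>var2\<close> has smaller degree than
  \<open>var1\<close> with respect to \<open>D\<close>. Then \<open>P\<close> is a polynomial in
  \<open>U\<close> and \<open>W\<close> plus a term \<open>c V\<close> with \<open>c\<close> in
  \<open>k[U]\<close>, and \<open>D\<close> is triangular in the order
  \<open>U, W, V\<close>.\<close>

lemma triangularizable_if_degrees_differ:
  fixes D :: "'k::field_char_0 poly3 \<Rightarrow> 'k poly3"
  assumes D: "irreducible_homogeneous_lnd D (int p - 2)" and "D var0 = 0" and p: "prime p"
    and deg: "(D ^^ m) var2 = 0" "(D ^^ m) var1 \<noteq> 0"
  shows "triangularizable D"
proof -
  interpret D: ring_derivation D by (rule irreducible_homogeneous_lndD[OF D])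
  note const = const_poly2_in_kernel[OF D \<open>D var0 = 0\<close>]
  obtain P where P: "pderiv1 P = D var2" "pderiv P = - D var1"
    and P_deg: "\<And>i j l. coeff (coeff2 P j l) i \<noteq> 0 \<Longrightarrow> (j = 0 \<and> l = 0) \<or> i + j + l = p"
    and P_top: "\<exists>j l. j + l = p \<and> coeff2 P j l \<noteq> 0"
    using homogeneous_potential[OF D \<open>D var0 = 0\<close> prime_ge_2_nat[OF p]] by blast
  have supp: "j = 0 \<or> (j = 1 \<and> l = 0)" if jl: "coeff2 P j l \<noteq> 0" for j l
  proof (cases "D var2 = 0")
    \<comment> \<open>Degree 0 of \<open>var2\<close> is not covered by
      \<open>prime_degree_support\<close>; here \<open>P\<close> simply does not involve
      \<open>var1\<close>.\<close>
    case True
    show ?thesis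
    proof (cases j)
      case (Suc j')
      have "of_nat (Suc j') * coeff2 P (Suc j') l = 0"
        using coeff2_pderiv1[of P j' l] P(1) True by simp
      then show ?thesis using jl Suc by (simp del: of_nat_Suc)
    qed simp
  next
    case False
    have "var1 \<noteq> (0 :: 'k poly3)" "var2 \<noteq> (0 :: 'k poly3)"
      by (simp_all add: var1_def var2_def)
    then obtain a u b v where u: "D.lead a var1 u" "u \<noteq> 0" and v: "D.lead b var2 v" "v \<noteq> 0"
      using ex_lead[OF D] by metis
    have "0 < b" using v False by (cases b) (auto simp: D.lead_def)
    have "b < m"
    proof (rule ccontr)
      assume "\<not> b < m"
      then have "(D ^^ b) var2 = 0" using D.funpow_eq_0_mono[OF deg(1)] by simp
      then show False using D.lead_nonzero[OF v] by simp
    qed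
    moreover have "m \<le> a"
    proof (rule ccontr)
      assume "\<not> m \<le> a"
      then have "(D ^^ m) var1 = 0" using D.funpow_eq_0_mono[of "Suc a" var1 m] u(1)
        unfolding D.lead_def by (simp del: funpow.simps)
      then show False using deg(2) by simp
    qed
    ultimately have "b < a" by simp
    have le: "j + l \<le> p" if nz: "coeff2 P j l \<noteq> 0" for j l
    proof -
      obtain i where "coeff (coeff2 P j l) i \<noteq> 0" using nz by (metis leading_coeff_0_iff)
      then show ?thesis using P_deg by fastforce
    qed
    obtain j0 l0 where "coeff2 P j0 l0 \<noteq> 0" "j0 + l0 = p" using P_top by blast
    then show ?thesis
      using prime_degree_support[OF D.ring_derivation_axioms const u(1) v(1) irreducible_homogeneous_lndD(3)[OF D]
          u(2) v(2) \<open>0 < b\<close> \<open>b < a\<close> P le _ _ p jl] by blast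
  qed
  define X :: "nat \<Rightarrow> 'k poly3" where "X i = (if i = 1 then var0 else if i = 2 then var2 else var1)" for i
  have X: "X 1 = var0" "X 2 = var2" "X 3 = var1" by (simp_all add: X_def)
  have "D var2 \<in> adjoin {var0}"
  proof (rule adjoin_coeffs)
    fix i j l assume "coeff (coeff2 (D var2) j l) i \<noteq> 0"
    then have "coeff2 P (Suc j) l \<noteq> 0" by (auto simp: P(1)[symmetric] coeff2_pderiv1)
    from supp[OF this] have "j = 0" "l = 0" by auto
    moreover have "var0 ^ i \<in> adjoin {var0 :: 'k poly3}" by (intro adjoin_power adjoin.gen) simp
    ultimately show "var0 ^ i * var1 ^ j * var2 ^ l \<in> adjoin {var0 :: 'k poly3}" by simp
  qed
  moreover have "D var1 \<in> adjoin {var0, var2}"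
  proof (rule adjoin_coeffs)
    fix i j l assume nz: "coeff (coeff2 (D var1) j l) i \<noteq> 0"
    have "coeff2 P j (Suc l) \<noteq> 0"
    proof
      assume "coeff2 P j (Suc l) = 0"
      then have "coeff2 (pderiv P) j l = 0" by (simp add: coeff2_pderiv)
      then show False using nz unfolding P(2) by simp
    qed
    from supp[OF this] have "j = 0" by auto
    moreover have "var0 ^ i * var2 ^ l \<in> adjoin {var0, var2 :: 'k poly3}"
      by (intro adjoin.mult adjoin_power adjoin.gen) simp_all
    ultimately show "var0 ^ i * var1 ^ j * var2 ^ l \<in> adjoin {var0, var2 :: 'k poly3}" by simp
  qed
  moreover have "D var0 \<in> range const3"
    using \<open>D var0 = 0\<close> by (metis const3_0 rangeI)
  moreover have "adjoin {var0, var2, var1} = (UNIV :: 'k poly3 set)"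
    using adjoin_vars by (simp add: insert_commute)
  ultimately show ?thesis
    unfolding triangularizable_def coordinate_system_def by (intro exI[of _ X]) (simp only: X simp_thms)
qed

section \<open>Reduction to a variable in the kernel\<close>

text \<open>\<open>f x y z i\<close> and \<open>g x y z i\<close> for \<open>i = 0, 1, 2\<close> are the components of mutually inverse
  polynomial maps; being polynomial is expressed by commuting with all homomorphisms.\<close>

lemma ex_graded_inverses:
  fixes f g :: "'k::field_char_0 poly3 \<Rightarrow> 'k poly3 \<Rightarrow> 'k poly3 \<Rightarrow> nat \<Rightarrow> 'k poly3"
  assumes hom: "\<And>i. f var0 var1 var2 i \<in> homogeneous_component 1" "\<And>i. g var0 var1 var2 i \<in> homogeneous_component 1"
    and nat: "\<And>\<phi> x y z i. alg_hom \<phi> \<Longrightarrow> \<phi> (f x y z i) = f (\<phi> x) (\<phi> y) (\<phi> z) i"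
      "\<And>\<phi> x y z i. alg_hom \<phi> \<Longrightarrow> \<phi> (g x y z i) = g (\<phi> x) (\<phi> y) (\<phi> z) i"
    and inv: "\<And>x y z. f (g x y z 0) (g x y z 1) (g x y z 2) 0 = x"
      "\<And>x y z. f (g x y z 0) (g x y z 1) (g x y z 2) 1 = y"
      "\<And>x y z. f (g x y z 0) (g x y z 1) (g x y z 2) 2 = z"
      "\<And>x y z. g (f x y z 0) (f x y z 1) (f x y z 2) 0 = x"
      "\<And>x y z. g (f x y z 0) (f x y z 1) (f x y z 2) 1 = y"
      "\<And>x y z. g (f x y z 0) (f x y z 1) (f x y z 2) 2 = z"
  obtains \<phi> \<psi> where "graded_inverses \<phi> \<psi>"
    "\<phi> var0 = f var0 var1 var2 0" "\<phi> var1 = f var0 var1 var2 1" "\<phi> var2 = f var0 var1 var2 2"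
proof -
  obtain \<phi> where \<phi>: "alg_hom \<phi>"
    "\<phi> var0 = f var0 var1 var2 0" "\<phi> var1 = f var0 var1 var2 1" "\<phi> var2 = f var0 var1 var2 2"
    using ex_alg_hom by blast
  obtain \<psi> where \<psi>: "alg_hom \<psi>"
    "\<psi> var0 = g var0 var1 var2 0" "\<psi> var1 = g var0 var1 var2 1" "\<psi> var2 = g var0 var1 var2 2"
    using ex_alg_hom by blast
  have "graded_inverses \<phi> \<psi>"
  proof (rule graded_inversesI[OF \<phi>(1) \<psi>(1)])
    fix x :: "'k poly3" assume x: "x \<in> {var0, var1, var2}"
    show "\<phi> x \<in> homogeneous_component 1" "\<psi> x \<in> homogeneous_component 1"
      using x hom by (auto simp: \<phi> \<psi>)
    show "\<phi> (\<psi> x) = x" "\<psi> (\<phi> x) = x"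
      using x by (auto simp: \<phi>(2-) \<psi>(2-) nat(1)[OF \<psi>(1)] nat(2)[OF \<phi>(1)] inv[unfolded One_nat_def])
  qed
  with \<phi> that show thesis by blast
qed

text \<open>Any nonzero linear form can serve as the first of three linear coordinates: a nonzero
  coefficient is the pivot, and its variable is exchanged with \<open>var0\<close> if
  necessary.\<close>

lemma ex_graded_linear:
  fixes a b c :: "'k::field_char_0"
  assumes "a \<noteq> 0 \<or> b \<noteq> 0 \<or> c \<noteq> 0"
  obtains \<phi> \<psi> where "graded_inverses \<phi> \<psi>"
    "\<phi> var0 = const3 a * var0 + const3 b * var1 + const3 c * var2"
proof -
  note hc = homogeneous_component_add homogeneous_component_scale homogeneous_component_var
    homogeneous_component_diff
  have cancel: "f + g + h - g - h = f" "f - g - h + g + h = f" "f - g + g = f" for f g h :: "'k poly3"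
    by simp_all
  have inv: "const3 a * (const3 (inverse a) * f) = f" "const3 (inverse a) * (const3 a * f) = f"
    if "a \<noteq> 0" for a and f :: "'k poly3"
    using const3_inverse[OF that, of f] by (simp_all add: ac_simps)
  consider "a \<noteq> 0" | "a = 0" "b \<noteq> 0" | "a = 0" "b = 0" "c \<noteq> 0" using assms by blast
  then show thesis
  proof cases
    case 1
    show thesis
      by (rule ex_graded_inverses[
            of "\<lambda>x y z i. if i = 0 then const3 a * x + const3 b * y + const3 c * z else if i = 1 then y else z"
               "\<lambda>x y z i. if i = 0 then const3 (inverse a) * (x - const3 b * y - const3 c * z) else if i = 1 then y else z"])
        (use that in \<open>auto intro!: hc simp: alg_homD inv[OF 1] cancel\<close>)
  next
    case 2
    show thesis
      by (rule ex_graded_inverses[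
            of "\<lambda>x y z i. if i = 0 then const3 b * y + const3 c * z else if i = 1 then x else z"
               "\<lambda>x y z i. if i = 0 then y else if i = 1 then const3 (inverse b) * (x - const3 c * z) else z"])
        (use that 2 in \<open>auto intro!: hc simp: alg_homD inv[OF 2(2)] const3_0 cancel\<close>)
  next
    case 3
    show thesis
      by (rule ex_graded_inverses[
            of "\<lambda>x y z i. if i = 0 then const3 c * z else if i = 1 then y else x"
               "\<lambda>x y z i. if i = 0 then z else if i = 1 then y else const3 (inverse c) * x"])
        (use that 3 in \<open>auto intro!: hc simp: alg_homD inv[OF 3(3)] const3_0\<close>)
  qed
qed

text \<open>Compare the degrees \<open>m\<close> of \<open>V\<close> and \<open>n\<close> of
  \<open>W\<close>: unequal degrees are settled up to a swap, and equal ones are made unequal by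
  subtracting a multiple of \<open>V\<close> from \<open>W\<close>.\<close>

lemma triangularizable_if_var0_in_kernel:
  fixes D :: "'k::field_char_0 poly3 \<Rightarrow> 'k poly3"
  assumes D: "irreducible_homogeneous_lnd D (int p - 2)" and D0: "D var0 = 0" and p: "prime p"
  shows "triangularizable D"
proof -
  interpret D: ring_derivation D by (rule irreducible_homogeneous_lndD[OF D])
  note const = const_poly2_in_kernel[OF D D0]
  have "var1 \<noteq> (0 :: 'k poly3)" "var2 \<noteq> (0 :: 'k poly3)"
    by (simp_all add: var1_def var2_def)
  then obtain m u n v where u: "D.lead m var1 u" "u \<noteq> 0" and v: "D.lead n var2 v" "v \<noteq> 0"
    using ex_lead[OF D] by metis
  have vanish: "(D ^^ l) f = 0" if "D.lead k f w" "k < l" for k l f w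
    using D.lead_mono[OF that] by (simp add: D.lead_def)
  \<comment> \<open>Iterates of the conjugate at a variable correspond to iterates of
    \<open>D\<close> at its image, so degrees are tested on \<open>\<phi> var1\<close> and
    \<open>\<phi> var2\<close>.\<close>
  have conjugate: "triangularizable D"
    if \<phi>\<psi>: "graded_inverses \<phi> \<psi>" and "\<phi> var0 = var0"
      and "(D ^^ k) (\<phi> var2) = 0" "(D ^^ k) (\<phi> var1) \<noteq> 0" for \<phi> \<psi> k
  proof (rule triangularizable_conjugate[OF \<phi>\<psi>],
      rule triangularizable_if_degrees_differ[OF irreducible_homogeneous_lnd_conjugate[OF D \<phi>\<psi>] _ p])
    have \<phi>: "alg_hom \<phi>" and \<psi>: "alg_hom \<psi>" and inv: "\<And>f. \<phi> (\<psi> f) = f" "\<And>f. \<psi> (\<phi> f) = f"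
      using \<phi>\<psi> by (auto simp: graded_inverses_def)
    show "\<psi> (D (\<phi> var0)) = 0" by (simp add: that(2) D0 alg_homD[OF \<psi>])
    show "((\<lambda>f. \<psi> (D (\<phi> f))) ^^ k) var2 = 0"
      unfolding funpow_conjugate[OF inv] that(3) by (rule alg_homD[OF \<psi>])
    show "((\<lambda>f. \<psi> (D (\<phi> f))) ^^ k) var1 \<noteq> 0"
      unfolding funpow_conjugate[OF inv] using that(4) by (metis alg_homD(4)[OF \<phi>] inv(1))
  qed
  note hc = homogeneous_component_add homogeneous_component_scale homogeneous_component_var
    homogeneous_component_diff
  consider "n < m" | "m < n" | "m = n" by linarith
  then show ?thesis
  proof cases
    case 1
    then show ?thesis
      using triangularizable_if_degrees_differ[OF D D0 p] vanish[OF v(1)] D.lead_nonzero[OF u] by blast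
  next
    case 2
    obtain \<phi> \<psi> where "graded_inverses \<phi> \<psi>" and \<phi>: "\<phi> var0 = var0" "\<phi> var1 = var2" "\<phi> (var2 :: 'k poly3) = var1"
      by (rule ex_graded_inverses[of "\<lambda>x y z i. if i = 0 then x else if i = 1 then z else y"
            "\<lambda>x y z i. if i = 0 then x else if i = 1 then z else y"]) (auto intro!: hc)
    then show ?thesis
      using conjugate[of \<phi> \<psi> n] vanish[OF u(1) 2] D.lead_nonzero[OF v] by simp
  next
    case 3
    \<comment> \<open>If both degrees were zero, \<open>D\<close> would vanish, against
      irreducibility with divisor 0.\<close>
    have "0 < m"
    proof (rule ccontr)
      assume "\<not> 0 < m"
      then have "D var1 = 0" "D var2 = 0" using u(1) v(1) 3 by (simp_all add: D.lead_def)
      then have "D f = 0" for f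
        using derivation_eq_pderiv[OF D.ring_derivation_axioms const, of f] by simp
      then have "(0 :: 'k poly3) dvd 1" using irreducible_homogeneous_lndD(5)[OF D, of 0] by simp
      then show False by simp
    qed
    have p2: "p \<ge> 2" by (rule prime_ge_2_nat[OF p])
    obtain P where P: "pderiv1 P = D var2" "pderiv P = - D var1"
      and P_deg: "\<And>i j l. coeff (coeff2 P j l) i \<noteq> 0 \<Longrightarrow> (j = 0 \<and> l = 0) \<or> i + j + l = p"
      and P_top: "\<exists>j l. j + l = p \<and> coeff2 P j l \<noteq> 0"
      using homogeneous_potential[OF D D0 p2] by blast
    have le: "m * j + m * l \<le> m * p" if nz: "coeff2 P j l \<noteq> 0" for j l
    proof -
      obtain i where "coeff (coeff2 P j l) i \<noteq> 0" using nz by (metis leading_coeff_0_iff)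
      then have "j + l \<le> p" using P_deg by fastforce
      then have "m * (j + l) \<le> m * p" by (rule mult_le_mono2)
      then show ?thesis by (simp only: distrib_left)
    qed
    define S where "S = {(j, l) \<in> supp2 P. m * j + m * l = m * p}"
    have S_deg: "fst x + snd x = p" if "x \<in> S" for x
    proof -
      have "m * (fst x + snd x) = m * p"
        using that unfolding S_def by (simp only: distrib_left mem_Collect_eq case_prod_unfold)
      then show ?thesis using \<open>0 < m\<close> by simp
    qed
    \<comment> \<open>\<open>P\<close> lies in the kernel while its top line has weight
      \<open>m * p > 0\<close>, so the leading sum must be zero.\<close>
    have "D P = 0"
      using derivation_eq_pderiv[OF D.ring_derivation_axioms const, of P] P by (simp add: mult.commute)
    then have "(D ^^ (m * p)) P = 0"
      using D.funpow_eq_0_mono[of 1 P "m * p"] \<open>0 < m\<close> p2 by simp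
    moreover have "D.lead (m * p) P (\<Sum>(j, l)\<in>S. [:[:coeff2 P j l:]:] * u ^ j * v ^ l)"
      unfolding S_def using lead_expansion[OF D.ring_derivation_axioms const u(1) v(1)[folded 3] le] .
    ultimately have sum: "(\<Sum>(j, l)\<in>S. [:[:coeff2 P j l:]:] * u ^ j * v ^ l) = 0"
      using D.lead_nonzero by blast
    \<comment> \<open>On the top line \<open>j + l = p\<close> already exhausts the degree, so
      \<open>U\<close> does not occur and the coefficients lie in \<open>k\<close>.\<close>
    have top_const: "[:[:coeff2 P (fst x) (snd x):]:] = const3 (coeff (coeff2 P (fst x) (snd x)) 0)"
      if "x \<in> S" for x
    proof -
      have "coeff (coeff2 P (fst x) (snd x)) i = coeff [:coeff (coeff2 P (fst x) (snd x)) 0:] i" for i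
      proof (cases i)
        case (Suc i')
        then have "coeff (coeff2 P (fst x) (snd x)) i = 0"
          using P_deg[of "fst x" "snd x" i] S_deg[OF that] p2 by fastforce
        then show ?thesis using Suc by simp
      qed simp
      then have "coeff2 P (fst x) (snd x) = [:coeff (coeff2 P (fst x) (snd x)) 0:]" by (rule poly_eqI)
      then show ?thesis unfolding const3_def by (rule arg_cong)
    qed
    have "(\<Sum>x\<in>S. const3 (coeff (coeff2 P (fst x) (snd x)) 0) * u ^ fst x * v ^ snd x)
        = (\<Sum>(j, l)\<in>S. [:[:coeff2 P j l:]:] * u ^ j * v ^ l)"
      unfolding case_prod_unfold by (intro sum.cong refl) (simp only: top_const)
    with sum have "(\<Sum>x\<in>S. const3 (coeff (coeff2 P (fst x) (snd x)) 0) * u ^ fst x * v ^ snd x) = 0"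
      by simp
    moreover obtain j0 l0 where jl0: "j0 + l0 = p" "coeff2 P j0 l0 \<noteq> 0" using P_top by blast
    then have "(j0, l0) \<in> S" using distrib_left[of m j0 l0] by (simp add: S_def supp2_def)
    moreover have "coeff (coeff2 P j0 l0) 0 \<noteq> 0"
    proof -
      obtain i where "coeff (coeff2 P j0 l0) i \<noteq> 0" using jl0(2) by (metis leading_coeff_0_iff)
      moreover from P_deg[OF this] have "i = 0" using jl0(1) p2 by auto
      ultimately show ?thesis by simp
    qed
    moreover have "finite S"
      by (rule finite_subset[OF _ finite_supp2[of P]]) (auto simp: S_def)
    ultimately obtain c where c: "v = const3 c * u"
      using homogeneous_relation_proportional[OF _ S_deg, of S "(j0, l0)"
          "\<lambda>x. coeff (coeff2 P (fst x) (snd x)) 0"] u(2) by auto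
    \<comment> \<open>The substitution removes the leading term: \<open>W - c V\<close> has degree
      below \<open>m\<close>, whereas \<open>V\<close> keeps degree \<open>m\<close>.\<close>
    obtain \<phi> \<psi> where "graded_inverses \<phi> \<psi>"
      and \<phi>: "\<phi> var0 = var0" "\<phi> var1 = var1" "\<phi> var2 = var2 - const3 c * var1"
      by (rule ex_graded_inverses[of "\<lambda>x y z i. if i = 0 then x else if i = 1 then y else z - const3 c * y"
            "\<lambda>x y z i. if i = 0 then x else if i = 1 then y else z + const3 c * y"])
        (auto intro!: hc simp: alg_homD)
    moreover have "(D ^^ m) (var2 - const3 c * var1) = 0"
    proof -
      have "D (const3 (- c)) = 0" by (rule irreducible_homogeneous_lndD[OF D])
      then have "D.lead m (var2 + const3 (- c) * var1) (v + const3 (- c) * u)"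
        using D.lead_add[OF v(1)[folded 3]] D.lead_mult[OF D.lead_const u(1)] by simp
      moreover have "const3 (- c) = - const3 c" by (simp add: const3_def)
      then have "var2 + const3 (- c) * var1 = var2 - const3 c * var1" "v + const3 (- c) * u = 0"
        by (simp_all add: c)
      ultimately show ?thesis by (simp add: D.lead_def)
    qed
    ultimately show ?thesis using conjugate[of \<phi> \<psi> m] D.lead_nonzero[OF u] by simp
  qed
qed

text \<open>\<open>D\<close> shifts all degrees by \<open>d\<close>, so no cancellation occurs
  between the images of different homogeneous parts of \<open>f\<close>.\<close>

lemma linear_part_in_kernel:
  assumes D: "irreducible_homogeneous_lnd D d" and "D f = 0"
  shows "D (const3 (coeff (coeff2 f 0 0) 1) * var0 + const3 (coeff (coeff2 f 1 0) 0) * var1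
    + const3 (coeff (coeff2 f 0 1) 0) * var2) = 0"
proof -
  interpret D: ring_derivation D by (rule irreducible_homogeneous_lndD[OF D])
  define L where "L = const3 (coeff (coeff2 f 0 0) 1) * var0 + const3 (coeff (coeff2 f 1 0) 0) * var1
    + const3 (coeff (coeff2 f 0 1) 0) * var2"
  have L: "L \<in> homogeneous_component 1"
    unfolding L_def
    by (intro homogeneous_component_add homogeneous_component_scale homogeneous_component_var)
  have coeff_L: "coeff (coeff2 L j l) i = coeff (coeff2 f j l) i" if "i + j + l = 1" for i j l
  proof -
    have "const3 a * var0 = monom2 (monom a 1) 0 0" "const3 a * var1 = monom2 [:a:] 1 0"
      "const3 a * var2 = monom2 [:a:] 0 1" for a :: 'a
      by (simp_all add: monom2_eq const_poly2_monom const3_def)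
    moreover have "(i = 1 \<and> j = 0 \<and> l = 0) \<or> (i = 0 \<and> j = 1 \<and> l = 0) \<or> (i = 0 \<and> j = 0 \<and> l = 1)"
      using that by auto
    ultimately show ?thesis by (auto simp: L_def coeff2_monom2)
  qed
  \<comment> \<open>\<open>R\<close> collects the polynomials without a component of degree
    \<open>1 + d\<close>. \<open>D L\<close> is homogeneous of that degree while
    \<open>D (f - L) = - D L\<close> lies in \<open>R\<close>, hence \<open>D L = 0\<close>.\<close>
  define R where "R = {g :: 'a poly3. \<forall>i j l. coeff (coeff2 g j l) i \<noteq> 0 \<longrightarrow> int (i + j + l) \<noteq> 1 + d}"
  have "D (f - L) \<in> R"
  proof (rule poly3_monom_induct[of "f - L" "\<lambda>g. D g \<in> R"])
    fix i j l assume nz: "coeff (coeff2 (f - L) j l) i \<noteq> 0"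
    have "coeff (coeff2 (f - L) j l) i = coeff (coeff2 f j l) i - coeff (coeff2 L j l) i"
      by (simp add: coeff2_def)
    then have ne: "i + j + l \<noteq> 1" using coeff_L nz by auto
    define M where "M = const3 (coeff (coeff2 (f - L) j l) i) * var0 ^ i * var1 ^ j * var2 ^ l"
    have "D M \<in> homogeneous_component (int (i + j + l) + d)"
      unfolding M_def by (intro irreducible_homogeneous_lndD(4)[OF D] homogeneous_component_monom homogeneous_component_var)
    then show "D M \<in> R" using ne unfolding R_def homogeneous_component_iff by fastforce
  next
    fix f g assume fg: "D f \<in> R" "D g \<in> R"
    show "D (f + g) \<in> R"
      unfolding R_def D.add
    proof (intro CollectI allI impI)
      fix i j l assume "coeff (coeff2 (D f + D g) j l) i \<noteq> 0"
      then have "coeff (coeff2 (D f) j l) i \<noteq> 0 \<or> coeff (coeff2 (D g) j l) i \<noteq> 0" by auto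
      then show "int (i + j + l) \<noteq> 1 + d" using fg unfolding R_def by blast
    qed
  qed (simp add: R_def)
  then have R: "- D L \<in> R" using \<open>D f = 0\<close> by (simp add: D.diff)
  have hc: "D L \<in> homogeneous_component (1 + d)" by (rule irreducible_homogeneous_lndD(4)[OF D L])
  have "coeff (coeff2 (D L) j l) i = 0" for i j l
  proof (rule ccontr)
    assume nz: "coeff (coeff2 (D L) j l) i \<noteq> 0"
    then have "int (i + j + l) = 1 + d" using hc unfolding homogeneous_component_iff by blast
    moreover have "coeff (coeff2 (- D L) j l) i \<noteq> 0" using nz by simp
    then have "int (i + j + l) \<noteq> 1 + d" using R unfolding R_def by blast
    ultimately show False by simp
  qed
  then have "D L = 0" by (intro poly2_eqI poly_eqI) simp
  then show ?thesis by (simp add: L_def)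
qed

text \<open>Linear parts at the origin obey a Leibniz rule, so those of
  \<open>k[X 1, X 2, X 3]\<close> are spanned by the linear parts of the \<open>X i\<close>. They
  fill a space of dimension 3, which two vectors cannot span.\<close>

lemma coordinate_linear_part_nonzero:
  fixes X :: "nat \<Rightarrow> 'k::field_char_0 poly3"
  assumes "coordinate_system X"
  shows "coeff (coeff2 (X 3) 0 0) 1 \<noteq> 0 \<or> coeff (coeff2 (X 3) 1 0) 0 \<noteq> 0 \<or> coeff (coeff2 (X 3) 0 1) 0 \<noteq> 0"
proof (rule ccontr)
  define L where "L = (\<lambda>(f :: 'k poly3) n :: nat. if n = 0 then coeff (coeff2 f 0 0) 1
    else if n = 1 then coeff (coeff2 f 1 0) 0 else coeff (coeff2 f 0 1) 0)"
  define c where "c = (\<lambda>f :: 'k poly3. coeff (coeff2 f 0 0) 0)"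
  assume "\<not> ?thesis"
  then have X3: "L (X 3) n = 0" for n by (simp add: L_def)
  have L_add: "L (f + g) n = L f n + L g n" for f g n by (simp add: L_def)
  have L_mult: "L (f * g) n = c f * L g n + c g * L f n" for f g n
    by (simp add: L_def c_def coeff2_mult coeff_mult coeff_sum)
  have span: "\<exists>a b. \<forall>n. L f n = a * L (X 1) n + b * L (X 2) n" for f
  proof -
    have "f \<in> adjoin {X 1, X 2, X 3}" using assms by (simp add: coordinate_system_def)
    then show ?thesis
    proof (induction rule: adjoin.induct)
      case (const k)
      have "L (const3 k) n = 0" for n by (simp add: L_def const3_def coeff2_def coeff_pCons)
      then show ?case by (intro exI[of _ 0]) simp
    next
      case (gen x)
      then consider "x = X 1" | "x = X 2" | "x = X 3" by blast
      then show ?case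
      proof cases
        case 1
        then show ?thesis by (intro exI[of _ 1] exI[of _ 0]) simp
      next
        case 2
        then show ?thesis by (intro exI[of _ 0] exI[of _ 1]) simp
      next
        case 3
        then show ?thesis by (intro exI[of _ 0]) (simp add: X3)
      qed
    next
      case (add f g)
      then obtain a b a' b' where "\<And>n. L f n = a * L (X 1) n + b * L (X 2) n"
        "\<And>n. L g n = a' * L (X 1) n + b' * L (X 2) n" by blast
      then show ?case
        by (intro exI[of _ "a + a'"] exI[of _ "b + b'"]) (simp add: L_add algebra_simps)
    next
      case (mult f g)
      then obtain a b a' b' where "\<And>n. L f n = a * L (X 1) n + b * L (X 2) n"
        "\<And>n. L g n = a' * L (X 1) n + b' * L (X 2) n" by blast
      then show ?case
        by (intro exI[of _ "c f * a' + c g * a"] exI[of _ "c f * b' + c g * b"])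
          (simp add: L_mult algebra_simps)
    qed
  qed
  define p q where "p = L (X 1)" and "q = L (X 2)"
  obtain a0 b0 where 0: "\<And>n. L var0 n = a0 * p n + b0 * q n" using span p_def q_def by blast
  obtain a1 b1 where 1: "\<And>n. L var1 n = a1 * p n + b1 * q n" using span p_def q_def by blast
  obtain a2 b2 where 2: "\<And>n. L var2 n = a2 * p n + b2 * q n" using span p_def q_def by blast
  have vars: "L var0 n = (if n = 0 then 1 else 0)" "L var1 n = (if n = 1 then 1 else 0)"
    "L var2 n = (if n = 0 \<or> n = 1 then 0 else 1)" for n
    by (simp_all add: L_def coeff2_def var0_def var1_def var2_def)
  note eqs = 0[of 0] 0[of 1] 0[of 2] 1[of 0] 1[of 1] 1[of 2] 2[of 0] 2[of 1] 2[of 2]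
  note eqs' = eqs[unfolded vars, simplified, symmetric]
  \<comment> \<open>The cross product of \<open>p\<close> and \<open>q\<close> is orthogonal to
    \<open>a2 p + b2 q = (0, 0, 1)\<close>, so its last entry vanishes.\<close>
  have "p 0 * q 1 - p 1 * q 0 = 0"
  proof -
    have "p 0 * q 1 - p 1 * q 0
        = (p 0 * q 1 - p 1 * q 0) * (a2 * p 2 + b2 * q 2)"
      using eqs' by simp
    also have "\<dots> = (p 1 * q 2 - p 2 * q 1) * - (a2 * p 0 + b2 * q 0)
        - (p 2 * q 0 - p 0 * q 2) * (a2 * p 1 + b2 * q 1)"
      by (simp add: algebra_simps)
    finally show ?thesis using eqs' by simp
  qed
  \<comment> \<open>The left side is a minor of the identity matrix and equals 1; the right side is
    a multiple of the minor just shown to vanish.\<close>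
  moreover have "(a0 * p 0 + b0 * q 0) * (a1 * p 1 + b1 * q 1) - (a0 * p 1 + b0 * q 1) * (a1 * p 0 + b1 * q 0)
      = (a0 * b1 - b0 * a1) * (p 0 * q 1 - p 1 * q 0)"
    by (simp add: algebra_simps)
  ultimately show False using eqs' by simp
qed

theorem corollary3p5:
  fixes D :: "'k::field_char_0 poly3 \<Rightarrow> 'k poly3" and p :: nat
  assumes "locally_nilpotent_derivation D"
    and "irreducible_derivation D"
    and "homogeneous_of_degree D (int p - 2)"
    and "has_rank D 2"
    and "prime p"
  shows "triangularizable D"
proof -
  \<comment> \<open>A common divisor of the image gives a principal ideal containing the ideal
    generated by the image; irreducibility makes that principal ideal the whole ring.\<close>
  have irreducible: "a dvd 1" if dvd: "\<And>f. a dvd D f" for a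
  proof -
    have ideal: "ideal_generated {a} = {f. a dvd f}"
      unfolding module.span_singleton[OF module_mult] by (auto simp: dvd_def mult.commute)
    have "range D \<subseteq> ideal_generated {a}" using dvd by (auto simp: ideal)
    then have "ideal_generated (range D) \<subseteq> ideal_generated {a}"
      by (rule module.span_minimal[OF module_mult _ module.subspace_span[OF module_mult]])
    then have "ideal_generated {a} = UNIV"
      using assms(2) unfolding irreducible_derivation_def by blast
    then show ?thesis unfolding ideal by auto
  qed
  have lnd: "ring_derivation D" "\<And>c. D (const3 c) = 0" "\<And>f. \<exists>n. (D ^^ n) f = 0"
    using assms(1) by (simp_all add: locally_nilpotent_derivation_def derivation_def ring_derivation_def)
  have graded: "D f \<in> homogeneous_component (e + (int p - 2))" if "f \<in> homogeneous_component e" for e f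
    using assms(3) that unfolding homogeneous_of_degree_def by (auto simp: image_subset_iff)
  have D: "irreducible_homogeneous_lnd D (int p - 2)"
    unfolding irreducible_homogeneous_lnd_def by (intro conjI allI ballI impI lnd graded irreducible) auto
  have "rank_witness D 2" using assms(4) by (simp add: has_rank_def)
  then obtain X where "coordinate_system X" and "\<forall>i\<in>{1..3}. if i \<le> 2 then D (X i) \<noteq> 0 else D (X i) = 0"
    unfolding rank_witness_def by (elim exE conjE) (rule that)
  then have X: "coordinate_system X" "D (X 3) = 0" by simp_all
  \<comment> \<open>The linear part of \<open>X 3\<close> is a nonzero linear form in the kernel;
    after a linear change of variables, \<open>var0\<close> takes its place.\<close>
  obtain \<phi> \<psi> where \<phi>\<psi>: "graded_inverses \<phi> \<psi>" and \<phi>: "\<phi> var0 = const3 (coeff (coeff2 (X 3) 0 0) 1) * var0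
      + const3 (coeff (coeff2 (X 3) 1 0) 0) * var1 + const3 (coeff (coeff2 (X 3) 0 1) 0) * var2"
    using ex_graded_linear[OF coordinate_linear_part_nonzero[OF X(1)]] by blast
  have "alg_hom \<psi>" using \<phi>\<psi> by (simp add: graded_inverses_def)
  then have "\<psi> (D (\<phi> var0)) = 0"
    unfolding \<phi> linear_part_in_kernel[OF D X(2)] by (rule alg_homD)
  from triangularizable_if_var0_in_kernel[OF irreducible_homogeneous_lnd_conjugate[OF D \<phi>\<psi>] this assms(5)]
  show ?thesis by (rule triangularizable_conjugate[OF \<phi>\<psi>])
qed

end
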